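(* Let $\mathcal{A}$ be any complete Boolean algebra. Then all the axioms (hence all the theorems) of $\mathbf{ZFC}$, when restricted to the pure $\mathbf{ZF}$-language $\mathcal{L}_p(\mathcal{T}_{\mathcal{A}})$ (with negation written $\sim$, membership written $\epsilon$ and equality written $\approx$), are valid in $\mathbf{V}^{\mathcal{T}_{\mathcal{A}^\ast}}$.
   Context: Let $\mathcal{A}=\langle A,\wedge,\vee,\to,\sim,0,1\rangle$ be a complete Boolean algebra and $T_{\mathcal{A}}=\{(z_1,z_2)\in A\times A : z_1\vee z_2=1\}$. The twist structure $\mathcal{T}_{\mathcal{A}^\ast}$ for the logic $(\mathbb{PS}_3,\neg)$ over $\mathcal{A}$ is $T_{\mathcal{A}}$ with the operations $(z_1,z_2)\tilde\wedge(w_1,w_2)=(z_1\wedge w_1,z_2\vee w_2)$; $(z_1,z_2)\tilde\vee(w_1,w_2)=(z_1\vee w_1,z_2\wedge w_2)$; $(z_1,z_2)\tilde\Rightarrow(w_1,w_2)=(z_1\to w_1,z_1\wedge\sim w_1)$; $\tilde\neg(z_1,z_2)=(z_2,z_1)$. The strong negation is derived, $\sim\varphi:=\varphi\Rightarrow\neg(\varphi\Rightarrow\varphi)$, giving $\tilde\sim(z_1,z_2)=(\sim z_1,z_1)$. $T_{\mathcal{A}}$ is a complete lattice with order $z\le w$ iff $z_1\le w_1$ and $z_2\ge w_2$, so $\bigwedge_i z_i=(\bigwedge_i (z_i)_1,\bigvee_i (z_i)_2)$ and $\bigvee_i z_i=(\bigvee_i (z_i)_1,\bigwedge_i (z_i)_2)$.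 The set of designated values is $D_{\mathcal{A}}=\{(1,a): a\in A\}$. The class $\mathbf{V}^{\mathcal{T}_{\mathcal{A}^\ast}}$ is defined by transfinite recursion: $\mathbf{V}_\alpha=\{x : x$ is a function, $ran(x)\subseteq T_{\mathcal{A}}$ and $dom(x)\subseteq \mathbf{V}_\xi$ for some $\xi<\alpha\}$, and $\mathbf{V}^{\mathcal{T}_{\mathcal{A}^\ast}}=\bigcup_\alpha\mathbf{V}_\alpha$. $\mathcal{L}_p(\mathcal{T}_{\mathcal{A}})$ (pure $\mathbf{ZF}$-language) is the first-order language with binary predicates $\epsilon$ (membership) and $\approx$ (identity), a constant for each element $u$ of $\mathbf{V}^{\mathcal{T}_{\mathcal{A}^\ast}}$ (identified with $u$), connectives $\wedge,\vee$, implication, and classical negation $\sim$ (not the paraconsistent $\neg$), and quantifiers $\forall,\exists$; implication is interpreted by $\tilde\Rightarrow$. Each sentence gets a value in $T_{\mathcal{A}}$ by: $\lbrack\!\lbrack u\,\epsilon\, v\rbrack\!\rbrack=\bigvee_{x\in dom(v)}(v(x)\,\tilde\wedge\,\lbrack\!\lbrack x\approx u\rbrack\!\rbrack)$; $\lbrack\!\lbrack u\approx v\rbrack\!\rbrack=\bigwedge_{x\in dom(u)}(u(x)\,\tilde\Rightarrow\,\lbrack\!\lbrack x\,\epsilon\, v\rbrack\!\rbrack)\ \tilde\wedge\ \bigwedge_{x\in dom(v)}(v(x)\,\tilde\Rightarrow\,\lbrack\!\lbrack x\,\epsilon\, u\rbrack\!\rbrack)$; $\wedge,\vee,\sim$ and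 implication are interpreted by $\tilde\wedge,\tilde\vee,\tilde\sim$ and $\tilde\Rightarrow$ respectively; $\lbrack\!\lbrack\forall x\varphi(x)\rbrack\!\rbrack=\bigwedge_{u}\lbrack\!\lbrack\varphi(u)\rbrack\!\rbrack$ and $\lbrack\!\lbrack\exists x\varphi(x)\rbrack\!\rbrack=\bigvee_{u}\lbrack\!\lbrack\varphi(u)\rbrack\!\rbrack$, with $u$ ranging over $\mathbf{V}^{\mathcal{T}_{\mathcal{A}^\ast}}$. A sentence is valid in $\mathbf{V}^{\mathcal{T}_{\mathcal{A}^\ast}}$ if its value lies in $D_{\mathcal{A}}$; a formula with free variables is valid if it is so under every assignment of elements of $\mathbf{V}^{\mathcal{T}_{\mathcal{A}^\ast}}$ to its free variables. *)

theory Defs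
  imports "HOL-Library.Multiset"
begin

section \<open>The ambient universe of sets\<close>

text \<open>
  The mathematics takes place in the universe of all sets.  A type of class \<open>zfc_universe\<close> is such
  a universe: its elements are the sets, and \<open>elts x\<close> is the extension of \<open>x\<close>.  A HOL set of type
  \<^typ>\<open>'v set\<close> plays the role of a class.  Separation and replacement are stated for all HOL
  predicates and functions; global choice is inherited from HOL.
\<close>

class zfc_universe =
  fixes elts :: "'a \<Rightarrow> 'a set"
  assumes extensionality: "elts x = elts y \<Longrightarrow> x = y"
    and foundation: "wf {(x, y). x \<in> elts y}"
    and pairing: "\<exists>z. elts z = {x, y}"
    and union: "\<exists>z. elts z = \<Union> (elts ` elts x)"
    and power: "\<exists>z. elts z = {y. elts y \<subseteq> elts x}"
    and infinity:
      "\<exists>w. (\<exists>e\<in>elts w. elts e = {}) \<and> (\<forall>x\<in>elts w. \<exists>y\<in>elts w. elts y = insert x (elts x))"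
    and separation: "\<exists>z. elts z = {y \<in> elts x. P y}"
    and replacement: "\<exists>z. elts z = f ` elts x"

definition set_of :: "'v set \<Rightarrow> 'v::zfc_universe"
  where "set_of X = (THE x. elts x = X)"

definition opair :: "'v \<Rightarrow> 'v \<Rightarrow> 'v::zfc_universe"
  where "opair x y = set_of {set_of {x}, set_of {x, y}}"

definition ordinal :: "'v::zfc_universe \<Rightarrow> bool"
  where "ordinal x \<longleftrightarrow>
    (\<forall>y\<in>elts x. elts y \<subseteq> elts x) \<and> (\<forall>y\<in>elts x. \<forall>z\<in>elts y. elts z \<subseteq> elts y)"

definition is_function :: "'v::zfc_universe \<Rightarrow> bool"
  where "is_function x \<longleftrightarrow>
    (\<forall>p\<in>elts x. \<exists>y z. p = opair y z) \<and>
    (\<forall>y z z'. opair y z \<in> elts x \<longrightarrow> opair y z' \<in> elts x \<longrightarrow> z = z')"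

definition dom_of :: "'v::zfc_universe \<Rightarrow> 'v set"
  where "dom_of x = {y. \<exists>z. opair y z \<in> elts x}"

definition ran_of :: "'v::zfc_universe \<Rightarrow> 'v set"
  where "ran_of x = {z. \<exists>y. opair y z \<in> elts x}"

lemma set_of_eq: "elts x = X \<Longrightarrow> set_of X = x"
  unfolding set_of_def by (blast intro: the_equality extensionality)

lemma elts_set_of_pair [simp]: "elts (set_of {x, y}) = {x, y}"
  using pairing[of x y] set_of_eq by metis

lemma elts_set_of_singleton [simp]: "elts (set_of {x}) = {x}"
  using elts_set_of_pair[of x x] by simp

lemma opair_inject [simp]: "opair x y = opair x' y' \<longleftrightarrow> x = x' \<and> y = y'"
proof
  assume eq: "opair x y = opair x' y'"
  have elts_opair: "elts ` elts (opair a b) = {{a}, {a, b}}" for a b :: 'a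
    by (simp add: opair_def)
  from eq have "{{x}, {x, y}} = {{x'}, {x', y'}}"
    by (metis elts_opair)
  then show "x = x' \<and> y = y'"
    unfolding doubleton_eq_iff by blast
qed simp

lemma wf_dom_of: "wf {(x, u::'v::zfc_universe). x \<in> dom_of u}"
proof -
  let ?E = "{(x, y::'v). x \<in> elts y}"
  have "(x, u) \<in> ?E\<^sup>+" if x: "x \<in> dom_of u" for x u :: 'v
  proof -
    obtain z where z: "opair x z \<in> elts u" using x by (auto simp: dom_of_def)
    have "(x, set_of {x}) \<in> ?E" by simp
    moreover have "(set_of {x}, opair x z) \<in> ?E" by (simp add: opair_def)
    moreover have "(opair x z, u) \<in> ?E" using z by simp
    ultimately show ?thesis by (meson r_into_trancl trancl_into_trancl)
  qed
  then have "{(x, u::'v). x \<in> dom_of u} \<subseteq> ?E\<^sup>+" by auto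
  then show ?thesis using wf_trancl[OF foundation] wf_subset by blast
qed


lemma dom_of_step:
  assumes "x \<in> dom_of u"
  shows "({#x, v#}, {#u, v#}) \<in> mult {(x, u). x \<in> dom_of u}"
    and "({#v, x#}, {#u, v#}) \<in> mult {(x, u). x \<in> dom_of u}"
    and "({#x, v#}, {#v, u#}) \<in> mult {(x, u). x \<in> dom_of u}"
    and "({#v, x#}, {#v, u#}) \<in> mult {(x, u). x \<in> dom_of u}"
proof -
  have "({#x, v#}, {#u, v#}) \<in> mult1 {(x, u). x \<in> dom_of u}"
    by (rule mult1I[of _ u "{#v#}" _ "{#x#}"]) (use assms in auto)
  then have "({#x, v#}, {#u, v#}) \<in> mult {(x, u). x \<in> dom_of u}"
    unfolding mult_def by blast
  then show "({#x, v#}, {#u, v#}) \<in> mult {(x, u). x \<in> dom_of u}"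
    "({#v, x#}, {#u, v#}) \<in> mult {(x, u). x \<in> dom_of u}"
    "({#x, v#}, {#v, u#}) \<in> mult {(x, u). x \<in> dom_of u}"
    "({#v, x#}, {#v, u#}) \<in> mult {(x, u). x \<in> dom_of u}"
    by (simp_all only: add_mset_commute)
qed


section \<open>The twist structure over a complete Boolean algebra\<close>

text \<open>
  Complete Boolean algebras are types of sort \<open>{boolean_algebra, complete_lattice}\<close>.  The library
  class \<^class>\<open>complete_boolean_algebra\<close> is too narrow: it demands complete distributivity.
\<close>

typedef (overloaded) 'a twist =
    "{z :: 'a::{boolean_algebra, complete_lattice} \<times> 'a. sup (fst z) (snd z) = top}"
  morphisms pair_of Twist
  by (rule exI[of _ "(top, top)"]) simp

definition tfst :: "'a::{boolean_algebra, complete_lattice} twist \<Rightarrow> 'a"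
  where "tfst z = fst (pair_of z)"

definition tsnd :: "'a::{boolean_algebra, complete_lattice} twist \<Rightarrow> 'a"
  where "tsnd z = snd (pair_of z)"

lemma sup_tfst_tsnd: "sup (tfst z) (tsnd z) = top"
  using pair_of[of z] by (simp add: tfst_def tsnd_def)

lemma twist_eqI: "tfst z = tfst w \<Longrightarrow> tsnd z = tsnd w \<Longrightarrow> z = w"
  by (metis pair_of_inject prod.expand tfst_def tsnd_def)

lemma tfst_Twist [simp]: "sup a b = top \<Longrightarrow> tfst (Twist (a, b)) = a"
  by (simp add: tfst_def Twist_inverse)

lemma tsnd_Twist [simp]: "sup a b = top \<Longrightarrow> tsnd (Twist (a, b)) = b"
  by (simp add: tsnd_def Twist_inverse)

lemma sup_eq_top_iff: "sup a b = top \<longleftrightarrow> - b \<le> (a :: 'a::boolean_algebra)"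
  by (metis sup_commute sup_shunt)

lemma sup_INF_SUP_eq_top:
  fixes f g :: "'i \<Rightarrow> 'a::{boolean_algebra, complete_lattice}"
  assumes "\<And>i. i \<in> I \<Longrightarrow> sup (f i) (g i) = top"
  shows "sup (Inf (f ` I)) (Sup (g ` I)) = top"
  unfolding sup_eq_top_iff
proof (rule INF_greatest)
  fix i assume "i \<in> I"
  then have "- g i \<le> f i" using assms by (simp add: sup_eq_top_iff)
  moreover have "- Sup (g ` I) \<le> - g i" using \<open>i \<in> I\<close> by (simp add: SUP_upper)
  ultimately show "- Sup (g ` I) \<le> f i" by order
qed

instantiation twist :: ("{boolean_algebra, complete_lattice}") complete_lattice
begin

definition less_eq_twist_def: "z \<le> w \<longleftrightarrow> tfst z \<le> tfst w \<and> tsnd w \<le> tsnd z"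
definition less_twist_def: "z < w \<longleftrightarrow> z \<le> w \<and> \<not> w \<le> (z :: 'a twist)"
definition inf_twist_def: "inf z w = Twist (inf (tfst z) (tfst w), sup (tsnd z) (tsnd w))"
definition sup_twist_def: "sup z w = Twist (sup (tfst z) (tfst w), inf (tsnd z) (tsnd w))"
definition Inf_twist_def: "Inf Z = Twist (Inf (tfst ` Z), Sup (tsnd ` Z))"
definition Sup_twist_def: "Sup Z = Twist (Sup (tfst ` Z), Inf (tsnd ` Z))"
definition top_twist_def: "top = Twist (top, bot)"
definition bot_twist_def: "bot = Twist (bot, top)"

lemma twist_components:
  fixes z w :: "'a twist"
  shows "tfst (inf z w) = inf (tfst z) (tfst w)" "tsnd (inf z w) = sup (tsnd z) (tsnd w)"
    and "tfst (sup z w) = sup (tfst z) (tfst w)" "tsnd (sup z w) = inf (tsnd z) (tsnd w)"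
    and "tfst (Inf Z) = Inf (tfst ` Z)" "tsnd (Inf Z) = Sup (tsnd ` Z)"
    and "tfst (Sup Z) = Sup (tfst ` Z)" "tsnd (Sup Z) = Inf (tsnd ` Z)"
    and "tfst (top :: 'a twist) = top" "tsnd (top :: 'a twist) = bot"
    and "tfst (bot :: 'a twist) = bot" "tsnd (bot :: 'a twist) = top"
proof -
  have le: "- tsnd z \<le> tfst z" "- tfst z \<le> tsnd z" for z :: "'a twist"
    using sup_tfst_tsnd[of z] by (simp_all add: sup_eq_top_iff[symmetric] sup_commute)
  have 1: "sup (inf (tfst z) (tfst w)) (sup (tsnd z) (tsnd w)) = top"
    unfolding sup_eq_top_iff using le by (metis compl_sup inf_mono)
  have 2: "sup (sup (tfst z) (tfst w)) (inf (tsnd z) (tsnd w)) = top"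
    unfolding sup_eq_top_iff using le by (metis compl_inf sup_mono)
  have 3: "sup (Inf (tfst ` Z)) (Sup (tsnd ` Z)) = top"
    by (rule sup_INF_SUP_eq_top) (rule sup_tfst_tsnd)
  have 4: "sup (Sup (tfst ` Z)) (Inf (tsnd ` Z)) = top"
    by (subst sup_commute, rule sup_INF_SUP_eq_top) (metis sup_commute sup_tfst_tsnd)
  show "tfst (inf z w) = inf (tfst z) (tfst w)" "tsnd (inf z w) = sup (tsnd z) (tsnd w)"
    "tfst (sup z w) = sup (tfst z) (tfst w)" "tsnd (sup z w) = inf (tsnd z) (tsnd w)"
    "tfst (Inf Z) = Inf (tfst ` Z)" "tsnd (Inf Z) = Sup (tsnd ` Z)"
    "tfst (Sup Z) = Sup (tfst ` Z)" "tsnd (Sup Z) = Inf (tsnd ` Z)"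
    "tfst (top :: 'a twist) = top" "tsnd (top :: 'a twist) = bot"
    "tfst (bot :: 'a twist) = bot" "tsnd (bot :: 'a twist) = top"
    by (simp_all add: inf_twist_def sup_twist_def Inf_twist_def Sup_twist_def
        top_twist_def bot_twist_def 1 2 3 4)
qed

instance
proof
  fix x y z :: "'a twist" and Z :: "'a twist set"
  show "x < y \<longleftrightarrow> x \<le> y \<and> \<not> y \<le> x"
    by (rule less_twist_def)
  show "x \<le> x"
    by (simp add: less_eq_twist_def)
  show "x \<le> z" if "x \<le> y" "y \<le> z"
    using that by (meson less_eq_twist_def order_trans)
  show "x = y" if "x \<le> y" "y \<le> x"
    using that by (simp add: less_eq_twist_def twist_eqI order.antisym)
  show "inf x y \<le> x" "inf x y \<le> y" "x \<le> sup x y" "y \<le> sup x y"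
    by (simp_all add: less_eq_twist_def twist_components)
  show "x \<le> inf y z" if "x \<le> y" "x \<le> z"
    using that by (simp add: less_eq_twist_def twist_components)
  show "sup y z \<le> x" if "y \<le> x" "z \<le> x"
    using that by (simp add: less_eq_twist_def twist_components)
  show "Inf Z \<le> x" "x \<le> Sup Z" if "x \<in> Z"
    using that by (simp_all add: less_eq_twist_def twist_components INF_lower SUP_upper)
  show "z \<le> Inf Z" if "\<And>x. x \<in> Z \<Longrightarrow> z \<le> x"
    using that by (auto simp: less_eq_twist_def twist_components intro: INF_greatest SUP_least)
  show "Sup Z \<le> z" if "\<And>x. x \<in> Z \<Longrightarrow> x \<le> z"
    using that by (auto simp: less_eq_twist_def twist_components intro: INF_greatest SUP_least)
  show "Inf {} = (top :: 'a twist)" "Sup {} = (bot :: 'a twist)"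
    by (rule twist_eqI; simp add: twist_components)+
qed

end

definition timp :: "'a::{boolean_algebra, complete_lattice} twist \<Rightarrow> 'a twist \<Rightarrow> 'a twist"
  where "timp z w = Twist (sup (- tfst z) (tfst w), inf (tfst z) (- tfst w))"

definition tneg :: "'a::{boolean_algebra, complete_lattice} twist \<Rightarrow> 'a twist"
  where "tneg z = Twist (tsnd z, tfst z)"

definition tsneg :: "'a::{boolean_algebra, complete_lattice} twist \<Rightarrow> 'a twist"
  where "tsneg z = timp z (tneg (timp z z))"

definition designated :: "'a::{boolean_algebra, complete_lattice} twist set"
  where "designated = {z. tfst z = top}"

lemma timp_components:
  "tfst (timp z w) = sup (- tfst z) (tfst w)" "tsnd (timp z w) = inf (tfst z) (- tfst w)"
proof -
  have "sup (sup (- a) b) (inf a (- b)) = top" for a b :: 'a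
    by (simp add: sup_eq_top_iff)
  then show "tfst (timp z w) = sup (- tfst z) (tfst w)"
    "tsnd (timp z w) = inf (tfst z) (- tfst w)"
    by (simp_all add: timp_def)
qed

lemma tneg_components: "tfst (tneg z) = tsnd z" "tsnd (tneg z) = tfst z"
  using sup_tfst_tsnd[of z] by (simp_all add: tneg_def sup_commute)

lemma tsneg_components: "tfst (tsneg z) = - tfst z" "tsnd (tsneg z) = tfst z"
  by (simp_all add: tsneg_def timp_components tneg_components)


section \<open>The class of names\<close>

text \<open>
  The Boolean algebra has to be a set of the universe.  This is expressed by an injection \<open>c\<close> of
  the type \<open>'a\<close> into the universe whose range is a set there; \<open>c a\<close> is the set that the element \<open>a\<close>
  is, and \<open>twist_code c z\<close> is the ordered pair of sets that \<open>z\<close> is.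
\<close>

definition is_coding :: "('a \<Rightarrow> 'v::zfc_universe) \<Rightarrow> bool"
  where "is_coding c \<longleftrightarrow> inj c \<and> (\<exists>A. elts A = range c)"

definition twist_code ::
    "('a::{boolean_algebra, complete_lattice} \<Rightarrow> 'v::zfc_universe) \<Rightarrow> 'a twist \<Rightarrow> 'v"
  where "twist_code c z = opair (c (tfst z)) (c (tsnd z))"

function level ::
    "('a::{boolean_algebra, complete_lattice} \<Rightarrow> 'v::zfc_universe) \<Rightarrow> 'v \<Rightarrow> 'v set"
  where "level c \<alpha> =
    {x. is_function x \<and> ran_of x \<subseteq> range (twist_code c) \<and> (\<exists>\<xi>\<in>elts \<alpha>. dom_of x \<subseteq> level c \<xi>)}"
  by auto
termination
  by (relation "inv_image {(x, y). x \<in> elts y} snd") (auto intro: foundation)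

declare level.simps [simp del]

definition names ::
    "('a::{boolean_algebra, complete_lattice} \<Rightarrow> 'v::zfc_universe) \<Rightarrow> 'v set"
  where "names c = (\<Union>\<alpha>\<in>{\<alpha>. ordinal \<alpha>}. level c \<alpha>)"

definition app ::
    "('a::{boolean_algebra, complete_lattice} \<Rightarrow> 'v::zfc_universe) \<Rightarrow> 'v \<Rightarrow> 'v \<Rightarrow> 'a twist"
  where "app c u x = (THE z. opair x (twist_code c z) \<in> elts u)"

function
  mem_val :: "('a::{boolean_algebra, complete_lattice} \<Rightarrow> 'v::zfc_universe) \<Rightarrow> 'v \<Rightarrow> 'v \<Rightarrow> 'a twist"
  and
  eq_val :: "('a::{boolean_algebra, complete_lattice} \<Rightarrow> 'v::zfc_universe) \<Rightarrow> 'v \<Rightarrow> 'v \<Rightarrow> 'a twist"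
  where
    "mem_val c u v = (SUP x\<in>dom_of v. inf (app c v x) (eq_val c x u))"
  | "eq_val c u v =
      inf (INF x\<in>dom_of u. timp (app c u x) (mem_val c x v))
          (INF x\<in>dom_of v. timp (app c v x) (mem_val c x u))"
  by pat_completeness auto
termination
  by (relation "inv_image (mult {(x, u). x \<in> dom_of u})
      (case_sum (\<lambda>(c, u, v). {#u, v#}) (\<lambda>(c, u, v). {#u, v#}))")
    (auto simp: dom_of_step intro: wf_inv_image wf_mult wf_dom_of)

declare mem_val.simps [simp del] eq_val.simps [simp del]


section \<open>The language of set theory and its interpretation\<close>

text \<open>Variables are named by natural numbers; \<open>'c\<close> is the type of constants.\<close>

datatype 'c trm = Var nat | Const 'c

datatype 'c form =
    Mem "'c trm" "'c trm"        (infix \<open>\<^bold>\<in>\<close> 50)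
  | Eql "'c trm" "'c trm"        (infix \<open>\<^bold>\<approx>\<close> 50)
  | Conj "'c form" "'c form"     (infixr \<open>\<^bold>\<and>\<close> 35)
  | Disj "'c form" "'c form"     (infixr \<open>\<^bold>\<or>\<close> 30)
  | Impl "'c form" "'c form"     (infixr \<open>\<^bold>\<longrightarrow>\<close> 25)
  | Neg "'c form"                (\<open>\<^bold>\<sim> _\<close> [40] 40)
  | All nat "'c form"            (\<open>(3\<^bold>\<forall>_./ _)\<close> [0, 10] 10)
  | Ex nat "'c form"             (\<open>(3\<^bold>\<exists>_./ _)\<close> [0, 10] 10)

abbreviation Iff :: "'c form \<Rightarrow> 'c form \<Rightarrow> 'c form"  (infixr \<open>\<^bold>\<longleftrightarrow>\<close> 25)
  where "\<phi> \<^bold>\<longleftrightarrow> \<psi> \<equiv> (\<phi> \<^bold>\<longrightarrow> \<psi>) \<^bold>\<and> (\<psi> \<^bold>\<longrightarrow> \<phi>)"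

definition lang :: "'c set \<Rightarrow> 'c form set"
  where "lang C = {\<phi>. set_form \<phi> \<subseteq> C}"

primrec trm_val :: "(nat \<Rightarrow> 'v) \<Rightarrow> 'v trm \<Rightarrow> 'v"
  where
    "trm_val \<rho> (Var x) = \<rho> x"
  | "trm_val \<rho> (Const u) = u"

primrec form_val ::
    "('a::{boolean_algebra, complete_lattice} \<Rightarrow> 'v::zfc_universe) \<Rightarrow> (nat \<Rightarrow> 'v) \<Rightarrow> 'v form \<Rightarrow> 'a twist"
  where
    "form_val c \<rho> (s \<^bold>\<in> t) = mem_val c (trm_val \<rho> s) (trm_val \<rho> t)"
  | "form_val c \<rho> (s \<^bold>\<approx> t) = eq_val c (trm_val \<rho> s) (trm_val \<rho> t)"
  | "form_val c \<rho> (\<phi> \<^bold>\<and> \<psi>) = inf (form_val c \<rho> \<phi>) (form_val c \<rho> \<psi>)"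
  | "form_val c \<rho> (\<phi> \<^bold>\<or> \<psi>) = sup (form_val c \<rho> \<phi>) (form_val c \<rho> \<psi>)"
  | "form_val c \<rho> (\<phi> \<^bold>\<longrightarrow> \<psi>) = timp (form_val c \<rho> \<phi>) (form_val c \<rho> \<psi>)"
  | "form_val c \<rho> (\<^bold>\<sim> \<phi>) = tsneg (form_val c \<rho> \<phi>)"
  | "form_val c \<rho> (\<^bold>\<forall>x. \<phi>) = (INF u\<in>names c. form_val c (\<rho>(x := u)) \<phi>)"
  | "form_val c \<rho> (\<^bold>\<exists>x. \<phi>) = (SUP u\<in>names c. form_val c (\<rho>(x := u)) \<phi>)"

definition valid ::
    "('a::{boolean_algebra, complete_lattice} \<Rightarrow> 'v::zfc_universe) \<Rightarrow> 'v form \<Rightarrow> bool"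
  where "valid c \<phi> \<longleftrightarrow> (\<forall>\<rho>. range \<rho> \<subseteq> names c \<longrightarrow> form_val c \<rho> \<phi> \<in> designated)"


section \<open>Axioms and theorems of ZFC\<close>

primrec trm_vars :: "'c trm \<Rightarrow> nat set"
  where
    "trm_vars (Var x) = {x}"
  | "trm_vars (Const u) = {}"

primrec free_vars :: "'c form \<Rightarrow> nat set"
  where
    "free_vars (s \<^bold>\<in> t) = trm_vars s \<union> trm_vars t"
  | "free_vars (s \<^bold>\<approx> t) = trm_vars s \<union> trm_vars t"
  | "free_vars (\<phi> \<^bold>\<and> \<psi>) = free_vars \<phi> \<union> free_vars \<psi>"
  | "free_vars (\<phi> \<^bold>\<or> \<psi>) = free_vars \<phi> \<union> free_vars \<psi>"
  | "free_vars (\<phi> \<^bold>\<longrightarrow> \<psi>) = free_vars \<phi> \<union> free_vars \<psi>"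
  | "free_vars (\<^bold>\<sim> \<phi>) = free_vars \<phi>"
  | "free_vars (\<^bold>\<forall>x. \<phi>) = free_vars \<phi> - {x}"
  | "free_vars (\<^bold>\<exists>x. \<phi>) = free_vars \<phi> - {x}"

text \<open>
  The schemas of separation and replacement may have parameters: \<open>\<phi>\<close> may contain constants and free
  variables other than those displayed.
\<close>

definition extensionality_axiom :: "'c form"
  where "extensionality_axiom =
    (\<^bold>\<forall>0. \<^bold>\<forall>1. (\<^bold>\<forall>2. Var 2 \<^bold>\<in> Var 0 \<^bold>\<longleftrightarrow> Var 2 \<^bold>\<in> Var 1) \<^bold>\<longrightarrow> Var 0 \<^bold>\<approx> Var 1)"

definition foundation_axiom :: "'c form"
  where "foundation_axiom =
    (\<^bold>\<forall>0. (\<^bold>\<exists>1. Var 1 \<^bold>\<in> Var 0) \<^bold>\<longrightarrow>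
      (\<^bold>\<exists>1. Var 1 \<^bold>\<in> Var 0 \<^bold>\<and> \<^bold>\<sim> (\<^bold>\<exists>2. Var 2 \<^bold>\<in> Var 0 \<^bold>\<and> Var 2 \<^bold>\<in> Var 1)))"

definition pairing_axiom :: "'c form"
  where "pairing_axiom =
    (\<^bold>\<forall>0. \<^bold>\<forall>1. \<^bold>\<exists>2. \<^bold>\<forall>3. Var 3 \<^bold>\<in> Var 2 \<^bold>\<longleftrightarrow> Var 3 \<^bold>\<approx> Var 0 \<^bold>\<or> Var 3 \<^bold>\<approx> Var 1)"

definition union_axiom :: "'c form"
  where "union_axiom =
    (\<^bold>\<forall>0. \<^bold>\<exists>1. \<^bold>\<forall>2. Var 2 \<^bold>\<in> Var 1 \<^bold>\<longleftrightarrow> (\<^bold>\<exists>3. Var 3 \<^bold>\<in> Var 0 \<^bold>\<and> Var 2 \<^bold>\<in> Var 3))"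

definition power_axiom :: "'c form"
  where "power_axiom =
    (\<^bold>\<forall>0. \<^bold>\<exists>1. \<^bold>\<forall>2. Var 2 \<^bold>\<in> Var 1 \<^bold>\<longleftrightarrow> (\<^bold>\<forall>3. Var 3 \<^bold>\<in> Var 2 \<^bold>\<longrightarrow> Var 3 \<^bold>\<in> Var 0))"

definition infinity_axiom :: "'c form"
  where "infinity_axiom =
    (\<^bold>\<exists>0. (\<^bold>\<exists>1. Var 1 \<^bold>\<in> Var 0 \<^bold>\<and> (\<^bold>\<forall>2. \<^bold>\<sim> Var 2 \<^bold>\<in> Var 1)) \<^bold>\<and>
      (\<^bold>\<forall>1. Var 1 \<^bold>\<in> Var 0 \<^bold>\<longrightarrow>
        (\<^bold>\<exists>2. Var 2 \<^bold>\<in> Var 0 \<^bold>\<and>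
          (\<^bold>\<forall>3. Var 3 \<^bold>\<in> Var 2 \<^bold>\<longleftrightarrow> Var 3 \<^bold>\<in> Var 1 \<^bold>\<or> Var 3 \<^bold>\<approx> Var 1))))"

text \<open>Every set of nonempty, pairwise disjoint sets has a transversal.\<close>

definition choice_axiom :: "'c form"
  where "choice_axiom =
    (\<^bold>\<forall>0. (\<^bold>\<forall>1. Var 1 \<^bold>\<in> Var 0 \<^bold>\<longrightarrow> (\<^bold>\<exists>2. Var 2 \<^bold>\<in> Var 1)) \<^bold>\<and>
        (\<^bold>\<forall>1. \<^bold>\<forall>2. Var 1 \<^bold>\<in> Var 0 \<^bold>\<and> Var 2 \<^bold>\<in> Var 0 \<^bold>\<and>
          (\<^bold>\<exists>3. Var 3 \<^bold>\<in> Var 1 \<^bold>\<and> Var 3 \<^bold>\<in> Var 2) \<^bold>\<longrightarrow> Var 1 \<^bold>\<approx> Var 2)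
      \<^bold>\<longrightarrow>
      (\<^bold>\<exists>4. \<^bold>\<forall>1. Var 1 \<^bold>\<in> Var 0 \<^bold>\<longrightarrow>
        (\<^bold>\<exists>2. \<^bold>\<forall>3. Var 3 \<^bold>\<in> Var 4 \<^bold>\<and> Var 3 \<^bold>\<in> Var 1 \<^bold>\<longleftrightarrow> Var 3 \<^bold>\<approx> Var 2)))"

definition separation_axiom :: "nat \<Rightarrow> nat \<Rightarrow> nat \<Rightarrow> 'c form \<Rightarrow> 'c form"
  where "separation_axiom a b x \<phi> =
    (\<^bold>\<forall>a. \<^bold>\<exists>b. \<^bold>\<forall>x. Var x \<^bold>\<in> Var b \<^bold>\<longleftrightarrow> Var x \<^bold>\<in> Var a \<^bold>\<and> \<phi>)"

text \<open>
  The premise of replacement says that for every \<open>x\<close> in \<open>a\<close> there is at most one \<open>y\<close> with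
  \<open>\<phi>(x, y)\<close>; it avoids substitution into \<open>\<phi>\<close> by naming a \<open>w\<close> that is equal to all such \<open>y\<close>.
\<close>

definition replacement_axiom :: "nat \<Rightarrow> nat \<Rightarrow> nat \<Rightarrow> nat \<Rightarrow> nat \<Rightarrow> 'c form \<Rightarrow> 'c form"
  where "replacement_axiom a b x y w \<phi> =
    (\<^bold>\<forall>a. (\<^bold>\<forall>x. Var x \<^bold>\<in> Var a \<^bold>\<longrightarrow> (\<^bold>\<exists>w. \<^bold>\<forall>y. \<phi> \<^bold>\<longrightarrow> Var y \<^bold>\<approx> Var w)) \<^bold>\<longrightarrow>
      (\<^bold>\<exists>b. \<^bold>\<forall>y. Var y \<^bold>\<in> Var b \<^bold>\<longleftrightarrow> (\<^bold>\<exists>x. Var x \<^bold>\<in> Var a \<^bold>\<and> \<phi>)))"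

definition zfc_axioms :: "'c set \<Rightarrow> 'c form set"
  where "zfc_axioms C =
    {extensionality_axiom, foundation_axiom, pairing_axiom, union_axiom, power_axiom,
      infinity_axiom, choice_axiom}
    \<union> {separation_axiom a b x \<phi> | a b x \<phi>.
        \<phi> \<in> lang C \<and> distinct [a, b, x] \<and> b \<notin> free_vars \<phi>}
    \<union> {replacement_axiom a b x y w \<phi> | a b x y w \<phi>.
        \<phi> \<in> lang C \<and> distinct [a, b, x, y, w] \<and> b \<notin> free_vars \<phi> \<and> w \<notin> free_vars \<phi>}"

text \<open>
  Theorems are what a Hilbert calculus for classical first-order logic with equality derives from
  the axioms.  \<open>subst x t \<phi>\<close> is the plain replacement of the free occurrences of \<open>x\<close>, to be used only
  if \<open>t\<close> is free for \<open>x\<close> in \<open>\<phi>\<close>.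
\<close>

primrec trm_subst :: "nat \<Rightarrow> 'c trm \<Rightarrow> 'c trm \<Rightarrow> 'c trm"
  where
    "trm_subst x t (Var y) = (if y = x then t else Var y)"
  | "trm_subst x t (Const u) = Const u"

primrec subst :: "nat \<Rightarrow> 'c trm \<Rightarrow> 'c form \<Rightarrow> 'c form"
  where
    "subst x t (r \<^bold>\<in> s) = (trm_subst x t r \<^bold>\<in> trm_subst x t s)"
  | "subst x t (r \<^bold>\<approx> s) = (trm_subst x t r \<^bold>\<approx> trm_subst x t s)"
  | "subst x t (\<phi> \<^bold>\<and> \<psi>) = (subst x t \<phi> \<^bold>\<and> subst x t \<psi>)"
  | "subst x t (\<phi> \<^bold>\<or> \<psi>) = (subst x t \<phi> \<^bold>\<or> subst x t \<psi>)"
  | "subst x t (\<phi> \<^bold>\<longrightarrow> \<psi>) = (subst x t \<phi> \<^bold>\<longrightarrow> subst x t \<psi>)"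
  | "subst x t (\<^bold>\<sim> \<phi>) = (\<^bold>\<sim> subst x t \<phi>)"
  | "subst x t (\<^bold>\<forall>y. \<phi>) = (\<^bold>\<forall>y. if y = x then \<phi> else subst x t \<phi>)"
  | "subst x t (\<^bold>\<exists>y. \<phi>) = (\<^bold>\<exists>y. if y = x then \<phi> else subst x t \<phi>)"

primrec free_for :: "'c trm \<Rightarrow> nat \<Rightarrow> 'c form \<Rightarrow> bool"
  where
    "free_for t x (r \<^bold>\<in> s) = True"
  | "free_for t x (r \<^bold>\<approx> s) = True"
  | "free_for t x (\<phi> \<^bold>\<and> \<psi>) = (free_for t x \<phi> \<and> free_for t x \<psi>)"
  | "free_for t x (\<phi> \<^bold>\<or> \<psi>) = (free_for t x \<phi> \<and> free_for t x \<psi>)"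
  | "free_for t x (\<phi> \<^bold>\<longrightarrow> \<psi>) = (free_for t x \<phi> \<and> free_for t x \<psi>)"
  | "free_for t x (\<^bold>\<sim> \<phi>) = free_for t x \<phi>"
  | "free_for t x (\<^bold>\<forall>y. \<phi>) =
      (x \<in> free_vars (\<^bold>\<forall>y. \<phi>) \<longrightarrow> y \<notin> trm_vars t \<and> free_for t x \<phi>)"
  | "free_for t x (\<^bold>\<exists>y. \<phi>) =
      (x \<in> free_vars (\<^bold>\<exists>y. \<phi>) \<longrightarrow> y \<notin> trm_vars t \<and> free_for t x \<phi>)"

inductive_set logical_axioms :: "'c form set"
  where
    "(\<phi> \<^bold>\<longrightarrow> \<psi> \<^bold>\<longrightarrow> \<phi>) \<in> logical_axioms"
  | "((\<phi> \<^bold>\<longrightarrow> \<psi> \<^bold>\<longrightarrow> \<chi>) \<^bold>\<longrightarrow> (\<phi> \<^bold>\<longrightarrow> \<psi>) \<^bold>\<longrightarrow> \<phi> \<^bold>\<longrightarrow> \<chi>) \<in> logical_axioms"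
  | "((\<^bold>\<sim> \<phi> \<^bold>\<longrightarrow> \<^bold>\<sim> \<psi>) \<^bold>\<longrightarrow> \<psi> \<^bold>\<longrightarrow> \<phi>) \<in> logical_axioms"
  | "(\<phi> \<^bold>\<and> \<psi> \<^bold>\<longrightarrow> \<phi>) \<in> logical_axioms"
  | "(\<phi> \<^bold>\<and> \<psi> \<^bold>\<longrightarrow> \<psi>) \<in> logical_axioms"
  | "(\<phi> \<^bold>\<longrightarrow> \<psi> \<^bold>\<longrightarrow> \<phi> \<^bold>\<and> \<psi>) \<in> logical_axioms"
  | "(\<phi> \<^bold>\<longrightarrow> \<phi> \<^bold>\<or> \<psi>) \<in> logical_axioms"
  | "(\<psi> \<^bold>\<longrightarrow> \<phi> \<^bold>\<or> \<psi>) \<in> logical_axioms"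
  | "((\<phi> \<^bold>\<longrightarrow> \<chi>) \<^bold>\<longrightarrow> (\<psi> \<^bold>\<longrightarrow> \<chi>) \<^bold>\<longrightarrow> \<phi> \<^bold>\<or> \<psi> \<^bold>\<longrightarrow> \<chi>) \<in> logical_axioms"
  | "free_for t x \<phi> \<Longrightarrow> ((\<^bold>\<forall>x. \<phi>) \<^bold>\<longrightarrow> subst x t \<phi>) \<in> logical_axioms"
  | "x \<notin> free_vars \<phi> \<Longrightarrow> ((\<^bold>\<forall>x. \<phi> \<^bold>\<longrightarrow> \<psi>) \<^bold>\<longrightarrow> \<phi> \<^bold>\<longrightarrow> (\<^bold>\<forall>x. \<psi>)) \<in> logical_axioms"
  | "free_for t x \<phi> \<Longrightarrow> (subst x t \<phi> \<^bold>\<longrightarrow> (\<^bold>\<exists>x. \<phi>)) \<in> logical_axioms"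
  | "x \<notin> free_vars \<psi> \<Longrightarrow> ((\<^bold>\<forall>x. \<phi> \<^bold>\<longrightarrow> \<psi>) \<^bold>\<longrightarrow> (\<^bold>\<exists>x. \<phi>) \<^bold>\<longrightarrow> \<psi>) \<in> logical_axioms"
  | "(t \<^bold>\<approx> t) \<in> logical_axioms"
  | "free_for s x \<phi> \<Longrightarrow> free_for t x \<phi> \<Longrightarrow>
      (s \<^bold>\<approx> t \<^bold>\<longrightarrow> subst x s \<phi> \<^bold>\<longrightarrow> subst x t \<phi>) \<in> logical_axioms"

inductive_set zfc_theorems :: "'c set \<Rightarrow> 'c form set" for C :: "'c set"
  where
    zfc_axiom: "\<phi> \<in> zfc_axioms C \<Longrightarrow> \<phi> \<in> zfc_theorems C"
  | logical_axiom: "\<phi> \<in> logical_axioms \<Longrightarrow> \<phi> \<in> lang C \<Longrightarrow> \<phi> \<in> zfc_theorems C"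
  | modus_ponens:
      "(\<phi> \<^bold>\<longrightarrow> \<psi>) \<in> zfc_theorems C \<Longrightarrow> \<phi> \<in> zfc_theorems C \<Longrightarrow> \<psi> \<in> zfc_theorems C"
  | generalization: "\<phi> \<in> zfc_theorems C \<Longrightarrow> (\<^bold>\<forall>x. \<phi>) \<in> zfc_theorems C"

end

theory Submission
  imports Defs
begin

text \<open>
  A designated value is one whose first component is \<open>\<top>\<close>, and on the connectives \<open>\<and>\<close>, \<open>\<or>\<close>, \<open>\<rightarrow>\<close>, \<open>\<sim>\<close>
  and on infima and suprema the first component of a twist value depends on the first components of
  the arguments only, through the operations of the Boolean algebra.  So \<^const>\<open>tfst\<close> turns the twist
  model, for formulas of the pure language, into a Scott-Solovay Boolean-valued model.  What has to be
  shown is that this model satisfies classical logic and ZFC.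
  
  Inequalities between truth values are proved in the style of forcing: \<open>p \<le> x\<close> is read as
  "p forces x", an implication is proved by passing to an arbitrary \<open>q \<le> p\<close>, and a supremum is
  used by passing to those \<open>q \<le> p\<close> that lie below one of its members.  That this last step is
  sound is the infinite distributive law, which every complete Boolean algebra satisfies.
  
  Logic.  Induction on the domains of names shows that equality is a congruence for membership; by
  induction on formulas (\<open>truth_cong\<close>) the value of a formula respects equality of its free variables.
  This one lemma yields both the substitution axiom for equality and the independence of variables that
  do not occur.
  
  Set existence.  There is a name for every function from a set of names into the algebra.
  Consequently a formula defines a set in the model as soon as its instances are, up to Boolean-valued
  equality, covered by a set of names (\<open>comprehension\<close>, \<open>set_existence\<close>).  For pairing, union and
  separation such a cover is built from the domain of the given name.  For power set it consists of the
  names with the same domain; they form a set because the algebra is a set.  For replacement one chooses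
  a witness \<open>y\<close> for each \<open>x\<close> in the domain and each possible truth value of \<open>\<phi>(x, y)\<close>.
  
  Foundation is inherited from the wellfoundedness of domains.  Infinity is witnessed by iterating an
  internal successor along the natural numbers.  For choice, a well-ordering of the universe selects
  the least name that is a member of \<open>x\<close>, to the extent given by a truth value.
\<close>

section \<open>Small sets\<close>

definition small :: "'v::zfc_universe set \<Rightarrow> bool"
  where "small X \<longleftrightarrow> (\<exists>z. elts z = X)"

lemma elts_set_of: "small X \<Longrightarrow> elts (set_of X) = X"
  unfolding small_def by (metis set_of_eq)

lemma small_elts: "small (elts x)"
  unfolding small_def by blast

lemma smallE:
  assumes "small X"
  obtains z where "elts z = X"
  using assms unfolding small_def by blast

lemma small_subset:
  assumes "small Y" "X \<subseteq> Y"
  shows "small X"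
proof -
  obtain y where "elts y = Y" using assms(1) by (auto simp: small_def)
  moreover obtain z where "elts z = {v \<in> elts y. v \<in> X}"
    using separation[of y "\<lambda>v. v \<in> X"] by blast
  ultimately have "elts z = X" using assms(2) by blast
  then show ?thesis by (auto simp: small_def)
qed

lemma small_empty: "small {}"
  using small_subset[OF small_elts] by blast

lemma small_doubleton: "small {x, y}"
  unfolding small_def by (rule pairing)

lemma small_image:
  fixes f :: "'v::zfc_universe \<Rightarrow> 'v"
  assumes "small X"
  shows "small (f ` X)"
proof -
  obtain x where "elts x = X" using assms by (auto simp: small_def)
  then show ?thesis using replacement[of f x] by (simp add: small_def)
qed

lemma small_Union:
  fixes F :: "'v::zfc_universe \<Rightarrow> 'v set"
  assumes "small X" "\<And>x. x \<in> X \<Longrightarrow> small (F x)"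
  shows "small (\<Union>x\<in>X. F x)"
proof -
  obtain z where z: "elts z = (\<lambda>x. set_of (F x)) ` X"
    by (rule smallE[OF small_image[OF assms(1), of "\<lambda>x. set_of (F x)"]])
  obtain w where "elts w = \<Union> (elts ` elts z)" using union[of z] by blast
  then have "elts w = (\<Union>x\<in>X. F x)" using z assms(2) by (simp add: elts_set_of)
  then show ?thesis by (auto simp: small_def)
qed

lemma small_Un:
  assumes "small X" "small Y"
  shows "small (X \<union> Y)"
proof -
  have "small (\<Union>z\<in>{set_of X, set_of Y}. elts z)"
    by (intro small_Union small_doubleton small_elts)
  then show ?thesis using assms by (simp add: elts_set_of)
qed

lemma small_insert: "small X \<Longrightarrow> small (insert x X)"
  using small_Un[OF small_doubleton[of x x]] by simp

lemma small_opairs: "small X \<Longrightarrow> small Y \<Longrightarrow> small (\<Union>x\<in>X. opair x ` Y)"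
  by (intro small_Union small_image)

lemma small_powerset:
  assumes "small X"
  shows "small {y. elts y \<subseteq> X}"
proof -
  obtain x where "elts x = X" using assms by (auto simp: small_def)
  then show ?thesis using power[of x] by (simp add: small_def)
qed

lemma not_elts_self: "x \<notin> elts x"
  using wf_not_refl[OF foundation] by blast

text \<open>
  An inductive set contains the finite von Neumann ordinals, and the cardinality of such an ordinal
  recovers its number; so replacement along \<open>f \<circ> card \<circ> elts\<close> collects the values of \<open>f\<close>.
\<close>

lemma small_range_nat: "small (range (f :: nat \<Rightarrow> 'v::zfc_universe))"
proof -
  obtain w :: 'v where e: "\<exists>e\<in>elts w. elts e = {}"
    and s: "\<forall>x\<in>elts w. \<exists>y\<in>elts w. elts y = insert x (elts x)"
    using infinity by blast
  \<comment> \<open>the successor step enlarges the cardinality since no set is a member of itself\<close>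
  have "\<exists>x\<in>elts w. finite (elts x) \<and> card (elts x) = n" for n
  proof (induction n)
    case 0
    from e obtain x where "x \<in> elts w" "elts x = {}" by blast
    then show ?case by (intro bexI[of _ x]) simp_all
  next
    case (Suc n)
    then obtain x where x: "x \<in> elts w" "finite (elts x)" "card (elts x) = n" by blast
    then obtain y where "y \<in> elts w" "elts y = insert x (elts x)" using s by blast
    then show ?case using x not_elts_self[of x] by (intro bexI[of _ y]) simp_all
  qed
  then have "n \<in> (\<lambda>x. card (elts x)) ` elts w" for n
    by (metis image_eqI)
  then have "(\<lambda>x. card (elts x)) ` elts w = UNIV" by blast
  then have "range f = (\<lambda>x. f (card (elts x))) ` elts w" by (metis image_image)
  then show ?thesis using small_image[OF small_elts] by metis
qed


section \<open>Names\<close>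

lemma ordinal_elts: "ordinal \<alpha> \<Longrightarrow> \<xi> \<in> elts \<alpha> \<Longrightarrow> ordinal \<xi>"
  unfolding ordinal_def by blast

lemma ordinal_Union:
  assumes "\<And>x. x \<in> X \<Longrightarrow> ordinal (\<alpha> x)" "elts \<beta> = (\<Union>x\<in>X. elts (\<alpha> x))"
  shows "ordinal \<beta>"
  using assms unfolding ordinal_def by (simp; blast)

lemma ordinal_insert:
  assumes "ordinal \<alpha>" "elts \<beta> = insert \<alpha> (elts \<alpha>)"
  shows "ordinal \<beta>"
  using assms unfolding ordinal_def by auto

lemma level_mono: "elts \<alpha> \<subseteq> elts \<beta> \<Longrightarrow> level c \<alpha> \<subseteq> level c \<beta>"
  by (subst (1 2) level.simps) blast

lemma small_dom_of: "small (dom_of u)"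
proof (rule small_subset)
  show "small ((\<lambda>p. SOME y. \<exists>z. p = opair y z) ` elts u)"
    by (intro small_image small_elts)
  have "(SOME y. \<exists>z. opair a b = opair y z) = a" for a b :: 'a
    by (rule some_equality) auto
  then show "dom_of u \<subseteq> (\<lambda>p. SOME y. \<exists>z. p = opair y z) ` elts u"
    unfolding dom_of_def by (force simp: image_iff)
qed

text \<open>
  An element of an ordinal is an ordinal, so the level that bounds the domain of a name consists of
  names itself.
\<close>

lemma dom_of_names:
  assumes "u \<in> names c"
  shows "dom_of u \<subseteq> names c"
proof -
  obtain \<alpha> where \<alpha>: "ordinal \<alpha>" "u \<in> level c \<alpha>" using assms by (auto simp: names_def)
  then obtain \<xi> where "\<xi> \<in> elts \<alpha>" "dom_of u \<subseteq> level c \<xi>"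
    by (subst (asm) level.simps) blast
  then show ?thesis using ordinal_elts[OF \<alpha>(1)] by (auto simp: names_def)
qed

text \<open>
  Replacement and union bound the levels at which the elements of a set of names appear, so that
  every set of names is the domain of a name.
\<close>

lemma names_bounded:
  fixes c :: "'a::{boolean_algebra, complete_lattice} \<Rightarrow> 'v::zfc_universe"
  assumes "small X" "X \<subseteq> names c"
  obtains \<alpha> where "ordinal \<alpha>" "X \<subseteq> level c \<alpha>"
proof -
  have "\<forall>x\<in>X. \<exists>\<alpha>. ordinal \<alpha> \<and> x \<in> level c \<alpha>" using assms(2) by (auto simp: names_def)
  then obtain \<alpha> where \<alpha>: "\<And>x. x \<in> X \<Longrightarrow> ordinal (\<alpha> x) \<and> x \<in> level c (\<alpha> x)" by metis
  have "small (\<Union>x\<in>X. elts (\<alpha> x))" using assms(1) by (intro small_Union small_elts)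
  then obtain \<beta> where \<beta>: "elts \<beta> = (\<Union>x\<in>X. elts (\<alpha> x))" by (auto simp: small_def)
  have "ordinal \<beta>" using ordinal_Union[OF _ \<beta>] \<alpha> by blast
  moreover have "X \<subseteq> level c \<beta>"
    using \<alpha> level_mono[of "\<alpha> _" \<beta> c] \<beta> by blast
  ultimately show thesis by (rule that)
qed

lemma names_intro:
  assumes "is_function u" "ran_of u \<subseteq> range (twist_code c)" "dom_of u \<subseteq> names c"
  shows "u \<in> names c"
proof -
  obtain \<alpha> where \<alpha>: "ordinal \<alpha>" "dom_of u \<subseteq> level c \<alpha>"
    using names_bounded[OF small_dom_of assms(3)] by blast
  obtain \<beta> where \<beta>: "elts \<beta> = insert \<alpha> (elts \<alpha>)"
    using smallE[OF small_insert[OF small_elts]] .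
  have "u \<in> level c \<beta>" using assms \<alpha>(2) \<beta> by (subst level.simps) auto
  then show ?thesis using ordinal_insert[OF \<alpha>(1) \<beta>] by (auto simp: names_def)
qed

lemma twist_code_inject: "is_coding c \<Longrightarrow> twist_code c z = twist_code c w \<longleftrightarrow> z = w"
  by (auto simp: is_coding_def twist_code_def dest: injD intro: twist_eqI)

lemma name_exists:
  assumes c: "is_coding c" and X: "small X" "X \<subseteq> names c"
  obtains u where "u \<in> names c" "dom_of u = X" "\<And>x. x \<in> X \<Longrightarrow> app c u x = f x"
proof -
  obtain u where u: "elts u = (\<lambda>x. opair x (twist_code c (f x))) ` X"
    by (rule smallE[OF small_image[OF X(1), of "\<lambda>x. opair x (twist_code c (f x))"]])
  have dom: "dom_of u = X" by (auto simp: dom_of_def u)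
  have "u \<in> names c"
  proof (rule names_intro)
    show "is_function u" unfolding is_function_def u by auto
    show "ran_of u \<subseteq> range (twist_code c)" unfolding ran_of_def u by auto
    show "dom_of u \<subseteq> names c" using X dom by simp
  qed
  moreover have "app c u x = f x" if "x \<in> X" for x
    unfolding app_def u by (rule the_equality) (use that twist_code_inject[OF c] in auto)
  ultimately show thesis using dom that by blast
qed

lemma small_range_coding: "is_coding c \<Longrightarrow> small (range c)"
  by (auto simp: is_coding_def small_def)

lemma small_range_twist_code: "is_coding c \<Longrightarrow> small (range (twist_code c))"
  by (rule small_subset[OF small_opairs[OF small_range_coding small_range_coding]])
    (auto simp: twist_code_def)

text \<open>
  Replacement is about functions on the universe; the coding transports a function on the algebra to
  one on the range of \<open>c\<close>.
\<close>

lemma small_image_algebra: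
  fixes c :: "'a \<Rightarrow> 'v::zfc_universe" and f :: "'a \<Rightarrow> 'v"
  assumes "is_coding c"
  shows "small (f ` S)"
proof (rule small_subset)
  show "small ((\<lambda>v. f (inv c v)) ` range c)"
    using assms by (intro small_image small_range_coding)
  have "inj c" using assms by (simp add: is_coding_def)
  then show "f ` S \<subseteq> (\<lambda>v. f (inv c v)) ` range c" by (auto simp: image_image)
qed

text \<open>
  Such a name is a subset of the product of its domain with the class of twist values, which is a set
  because the algebra is one.
\<close>

lemma small_names_with_domain:
  assumes "is_coding c" "small X"
  shows "small {u \<in> names c. dom_of u = X}"
proof (rule small_subset[OF small_powerset])
  show "small (\<Union>x\<in>X. opair x ` range (twist_code c))"
    using assms by (intro small_opairs small_range_twist_code)
  have "elts u \<subseteq> (\<Union>x\<in>X. opair x ` range (twist_code c))"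
    if u: "u \<in> names c" "dom_of u = X" for u
  proof
    fix p assume p: "p \<in> elts u"
    obtain \<alpha> where "u \<in> level c \<alpha>" using u(1) by (auto simp: names_def)
    then have "is_function u \<and> ran_of u \<subseteq> range (twist_code c)"
      by (subst (asm) level.simps) blast
    moreover from this obtain y z where "p = opair y z"
      using p unfolding is_function_def by blast
    ultimately have "p = opair y z" "z \<in> range (twist_code c)"
      using p unfolding ran_of_def by blast+
    then show "p \<in> (\<Union>x\<in>X. opair x ` range (twist_code c))"
      using p u(2) by (auto simp: dom_of_def)
  qed
  then show "{u \<in> names c. dom_of u = X} \<subseteq> {u. elts u \<subseteq> (\<Union>x\<in>X. opair x ` range (twist_code c))}"
    by blast
qed

section \<open>Reasoning below a condition\<close>

unbundle lattice_syntax

text \<open>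
  Introduction and elimination rules for the connectives, in the order \<open>q \<le> p\<close> of conditions.
  Passing to all smaller conditions is what makes them composable: facts about \<open>p\<close> descend to \<open>q\<close> by
  transitivity.
\<close>

lemma le_impI:
  fixes p :: "'a::boolean_algebra"
  assumes "\<And>q. q \<le> p \<Longrightarrow> q \<le> x \<Longrightarrow> q \<le> y"
  shows "p \<le> - x \<squnion> y"
  using assms[of "p \<sqinter> x"] by (simp add: shunt1)

lemma le_impD:
  fixes p :: "'a::boolean_algebra"
  assumes "p \<le> - x \<squnion> y" "p \<le> x"
  shows "p \<le> y"
  using assms by (metis shunt1 inf.absorb_iff1)

lemma le_complI:
  fixes p :: "'a::boolean_algebra"
  assumes "\<And>q. q \<le> p \<Longrightarrow> q \<le> x \<Longrightarrow> q \<le> \<bottom>"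
  shows "p \<le> - x"
proof -
  have "p \<le> - x \<squnion> \<bottom>" by (rule le_impI) (rule assms)
  then show ?thesis by simp
qed

lemma le_complD:
  fixes p :: "'a::boolean_algebra"
  assumes "p \<le> - x" "p \<le> x"
  shows "p \<le> y"
  using assms by (metis inf_compl_bot le_inf_iff bot_least order_trans)

lemma le_supE:
  fixes p :: "'a::boolean_algebra"
  assumes "p \<le> x \<squnion> y" "\<And>q. q \<le> p \<Longrightarrow> q \<le> x \<Longrightarrow> q \<le> z" "\<And>q. q \<le> p \<Longrightarrow> q \<le> y \<Longrightarrow> q \<le> z"
  shows "p \<le> z"
proof -
  have "x \<le> - p \<squnion> z" "y \<le> - p \<squnion> z"
    by (rule le_impI, rule assms(2), assumption+) (rule le_impI, rule assms(3), assumption+)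
  then show ?thesis using assms(1) by (meson le_impD le_sup_iff order_refl order_trans)
qed

text \<open>
  By adjunction \<open>f i \<le> - p \<squnion> z\<close> for all \<open>i\<close>, so the supremum lies below \<open>- p \<squnion> z\<close> as well.  This is
  the infinite distributive law in the form of an elimination rule.
\<close>

lemma le_SUPE:
  fixes p :: "'a::{boolean_algebra, complete_lattice}"
  assumes "p \<le> (\<Squnion>i\<in>I. f i)" "\<And>i q. i \<in> I \<Longrightarrow> q \<le> p \<Longrightarrow> q \<le> f i \<Longrightarrow> q \<le> z"
  shows "p \<le> z"
proof -
  have "(\<Squnion>i\<in>I. f i) \<le> - p \<squnion> z"
    by (rule SUP_least, rule le_impI) (use assms(2) order_trans in blast)
  then show ?thesis using assms(1) by (meson le_impD order_refl order_trans)
qed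

lemma le_SUPI:
  fixes p :: "'a::complete_lattice"
  shows "i \<in> I \<Longrightarrow> p \<le> f i \<Longrightarrow> p \<le> (\<Squnion>i\<in>I. f i)"
  by (rule SUP_upper2)

lemma eq_if_same_lower:
  fixes x y :: "'a::order"
  shows "(\<And>p. p \<le> x \<longleftrightarrow> p \<le> y) \<Longrightarrow> x = y"
  by (meson order.antisym order_refl)

lemma le_iffI:
  fixes p :: "'a::boolean_algebra"
  assumes "\<And>q. q \<le> p \<Longrightarrow> q \<le> x \<Longrightarrow> q \<le> y" "\<And>q. q \<le> p \<Longrightarrow> q \<le> y \<Longrightarrow> q \<le> x"
  shows "p \<le> (- x \<squnion> y) \<sqinter> (- y \<squnion> x)"
  using assms by (simp add: le_impI)


section \<open>Boolean-valued membership and equality\<close>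

locale boolean_valued_universe =
  fixes c :: "'a::{boolean_algebra, complete_lattice} \<Rightarrow> 'v::zfc_universe"
  assumes coding: "is_coding c"
begin

text \<open>
  First components of the values of the twist model.
\<close>

definition weight :: "'v \<Rightarrow> 'v \<Rightarrow> 'a"
  where "weight u x = tfst (app c u x)"

definition member :: "'v \<Rightarrow> 'v \<Rightarrow> 'a"  (infix \<open>\<in>\<^sub>B\<close> 85)
  where "u \<in>\<^sub>B v = tfst (mem_val c u v)"

definition equal :: "'v \<Rightarrow> 'v \<Rightarrow> 'a"  (infix \<open>=\<^sub>B\<close> 85)
  where "u =\<^sub>B v = tfst (eq_val c u v)"

lemma member_unfold: "u \<in>\<^sub>B v = (\<Squnion>x\<in>dom_of v. weight v x \<sqinter> x =\<^sub>B u)"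
  unfolding member_def equal_def weight_def
  by (subst mem_val.simps) (simp add: twist_components image_image)

lemma equal_unfold:
  "u =\<^sub>B v = (\<Sqinter>x\<in>dom_of u. - weight u x \<squnion> x \<in>\<^sub>B v) \<sqinter> (\<Sqinter>x\<in>dom_of v. - weight v x \<squnion> x \<in>\<^sub>B u)"
  unfolding member_def equal_def weight_def
  by (subst eq_val.simps) (simp add: twist_components timp_components image_image)

lemma memberI: "x \<in> dom_of v \<Longrightarrow> p \<le> weight v x \<Longrightarrow> p \<le> x =\<^sub>B u \<Longrightarrow> p \<le> u \<in>\<^sub>B v"
  unfolding member_unfold by (rule le_SUPI) simp_all

lemma memberE:
  assumes "p \<le> u \<in>\<^sub>B v"
    and "\<And>x q. x \<in> dom_of v \<Longrightarrow> q \<le> p \<Longrightarrow> q \<le> weight v x \<Longrightarrow> q \<le> x =\<^sub>B u \<Longrightarrow> q \<le> z"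
  shows "p \<le> z"
  using assms(1) unfolding member_unfold by (rule le_SUPE) (simp add: assms(2))

lemma equalI:
  assumes "\<And>x q. x \<in> dom_of u \<Longrightarrow> q \<le> p \<Longrightarrow> q \<le> weight u x \<Longrightarrow> q \<le> x \<in>\<^sub>B v"
    and "\<And>x q. x \<in> dom_of v \<Longrightarrow> q \<le> p \<Longrightarrow> q \<le> weight v x \<Longrightarrow> q \<le> x \<in>\<^sub>B u"
  shows "p \<le> u =\<^sub>B v"
  unfolding equal_unfold by (auto intro!: INF_greatest le_impI assms)

lemma equalD: "p \<le> u =\<^sub>B v \<Longrightarrow> x \<in> dom_of u \<Longrightarrow> p \<le> weight u x \<Longrightarrow> p \<le> x \<in>\<^sub>B v"
  unfolding equal_unfold by (auto simp: le_INF_iff intro: le_impD)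

lemma equal_commute: "u =\<^sub>B v = v =\<^sub>B u"
  unfolding equal_unfold by (simp add: inf_commute)

lemma equal_refl [simp]: "u =\<^sub>B u = \<top>"
proof (induction u rule: wf_induct_rule[OF wf_dom_of])
  case (1 u)
  then have "\<top> \<le> u =\<^sub>B u" by (intro equalI) (auto intro: memberI)
  then show ?case by (simp add: top_unique)
qed

lemma weight_le_member: "x \<in> dom_of v \<Longrightarrow> weight v x \<le> x \<in>\<^sub>B v"
  by (rule memberI) auto

text \<open>
  An element \<open>x\<close> of the domain of \<open>u\<close> is linked to some \<open>z\<close> in the domain of \<open>w\<close> through some \<open>y\<close> in
  the domain of \<open>v\<close>.  Both halves of the equality of \<open>u\<close> and \<open>w\<close> need transitivity for such a triple
  only in the direction that starts at \<open>x\<close>, so induction on \<open>u\<close> suffices.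
\<close>

lemma equal_trans: "p \<le> u =\<^sub>B v \<Longrightarrow> p \<le> v =\<^sub>B w \<Longrightarrow> p \<le> u =\<^sub>B w"
proof (induction u arbitrary: p v w rule: wf_induct_rule[OF wf_dom_of])
  case (1 u)
  have IH: "q \<le> x =\<^sub>B z" if "x \<in> dom_of u" "q \<le> x =\<^sub>B y" "q \<le> y =\<^sub>B z" for x q y z
    using 1(1) that by blast
  show ?case
  proof (rule equalI)
    fix x q assume x: "x \<in> dom_of u" "q \<le> p" "q \<le> weight u x"
    have "q \<le> x \<in>\<^sub>B v" by (rule equalD[OF order_trans[OF x(2) 1(2)] x(1,3)])
    then show "q \<le> x \<in>\<^sub>B w"
    proof (rule memberE)
      fix y r assume y: "y \<in> dom_of v" "r \<le> q" "r \<le> weight v y" "r \<le> y =\<^sub>B x"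
      have "r \<le> y \<in>\<^sub>B w" by (rule equalD[OF order_trans[OF order_trans[OF y(2) x(2)] 1(3)] y(1,3)])
      then show "r \<le> x \<in>\<^sub>B w"
      proof (rule memberE)
        fix z s assume z: "z \<in> dom_of w" "s \<le> r" "s \<le> weight w z" "s \<le> z =\<^sub>B y"
        have "s \<le> x =\<^sub>B y" using z(2) y(4) equal_commute[of x y] by (simp add: order_trans)
        then have "s \<le> x =\<^sub>B z" using IH[OF x(1)] z(4) equal_commute[of z y] by simp
        then show "s \<le> x \<in>\<^sub>B w" using z(1,3) equal_commute[of x z] by (simp add: memberI)
      qed
    qed
  next
    fix z q assume z: "z \<in> dom_of w" "q \<le> p" "q \<le> weight w z"
    have "q \<le> w =\<^sub>B v" using z(2) 1(3) equal_commute[of w v] by (simp add: order_trans)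
    then have "q \<le> z \<in>\<^sub>B v" using z equalD by blast
    then show "q \<le> z \<in>\<^sub>B u"
    proof (rule memberE)
      fix y r assume y: "y \<in> dom_of v" "r \<le> q" "r \<le> weight v y" "r \<le> y =\<^sub>B z"
      have "r \<le> v =\<^sub>B u"
        using order_trans[OF order_trans[OF y(2) z(2)] 1(2)] equal_commute[of v u] by simp
      then have "r \<le> y \<in>\<^sub>B u" using y equalD by blast
      then show "r \<le> z \<in>\<^sub>B u"
      proof (rule memberE)
        fix x s assume x: "x \<in> dom_of u" "s \<le> r" "s \<le> weight u x" "s \<le> x =\<^sub>B y"
        have "s \<le> x =\<^sub>B z" by (rule IH[OF x(1,4) order_trans[OF x(2) y(4)]])
        then show "s \<le> z \<in>\<^sub>B u" using x(1,3) by (simp add: memberI)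
      qed
    qed
  qed
qed

lemma equal_sym: "p \<le> u =\<^sub>B v \<Longrightarrow> p \<le> v =\<^sub>B u"
  using equal_commute by simp

lemma member_equal_left:
  assumes "p \<le> u \<in>\<^sub>B v" "p \<le> u =\<^sub>B w"
  shows "p \<le> w \<in>\<^sub>B v"
  using assms(1)
proof (rule memberE)
  fix x q assume x: "x \<in> dom_of v" "q \<le> p" "q \<le> weight v x" "q \<le> x =\<^sub>B u"
  show "q \<le> w \<in>\<^sub>B v"
    by (rule memberI[OF x(1,3) equal_trans[OF x(4) order_trans[OF x(2) assms(2)]]])
qed

lemma member_equal_right:
  assumes "p \<le> u \<in>\<^sub>B v" "p \<le> v =\<^sub>B w"
  shows "p \<le> u \<in>\<^sub>B w"
  using assms(1)
proof (rule memberE)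
  fix x q assume x: "x \<in> dom_of v" "q \<le> p" "q \<le> weight v x" "q \<le> x =\<^sub>B u"
  have "q \<le> x \<in>\<^sub>B w" by (rule equalD[OF order_trans[OF x(2) assms(2)] x(1,3)])
  then show "q \<le> u \<in>\<^sub>B w" using x(4) member_equal_left by blast
qed

text \<open>
  A pair \<open>(a, \<top>)\<close> belongs to the twist structure for every \<open>a\<close>, so weights can be prescribed at will.
\<close>

lemma name_from:
  assumes "small X" "X \<subseteq> names c"
  obtains u where "u \<in> names c" "dom_of u = X" "\<And>x. x \<in> X \<Longrightarrow> weight u x = f x"
proof -
  obtain u where u: "u \<in> names c" "dom_of u = X"
    and app: "\<And>x. x \<in> X \<Longrightarrow> app c u x = Twist (f x, \<top>)"
    by (rule name_exists[OF coding assms, of "\<lambda>x. Twist (f x, \<top>)"]) blast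
  have "weight u x = f x" if "x \<in> X" for x using app[OF that] by (simp add: weight_def)
  then show thesis by (rule that[OF u])
qed

text \<open>
  Respecting Boolean-valued equality is a property that every \<open>w \<mapsto> w \<in>\<^sub>B s\<close> has, hence necessary for
  a predicate to be a set of the model.
\<close>

definition extensional :: "('v \<Rightarrow> 'a) \<Rightarrow> bool"
  where "extensional \<phi> \<longleftrightarrow>
    (\<forall>u\<in>names c. \<forall>v\<in>names c. \<forall>p. p \<le> u =\<^sub>B v \<longrightarrow> p \<le> \<phi> u \<longrightarrow> p \<le> \<phi> v)"

lemma extensionalI:
  "(\<And>u v p. u \<in> names c \<Longrightarrow> v \<in> names c \<Longrightarrow> p \<le> u =\<^sub>B v \<Longrightarrow> p \<le> \<phi> u \<Longrightarrow> p \<le> \<phi> v) \<Longrightarrow> extensional \<phi>"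
  unfolding extensional_def by blast

text \<open>
  The name with domain \<open>X\<close> and weights \<open>\<phi>\<close> has the value \<open>\<Squnion>x\<in>X. \<phi> x \<sqinter> x =\<^sub>B w\<close> at \<open>w\<close>.
  Extensionality of \<open>\<phi>\<close> bounds this by \<open>\<phi> w\<close>, and the covering hypothesis gives the converse.
\<close>

lemma comprehension:
  assumes X: "small X" "X \<subseteq> names c" and ext: "extensional \<phi>"
    and bound: "\<And>w p. w \<in> names c \<Longrightarrow> p \<le> \<phi> w \<Longrightarrow> p \<le> (\<Squnion>x\<in>X. x =\<^sub>B w)"
  obtains s where "s \<in> names c" "\<And>w. w \<in> names c \<Longrightarrow> w \<in>\<^sub>B s = \<phi> w"
proof -
  obtain s where s: "s \<in> names c" "dom_of s = X" "\<And>x. x \<in> X \<Longrightarrow> weight s x = \<phi> x"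
    using name_from[OF X] by blast
  have "w \<in>\<^sub>B s = \<phi> w" if w: "w \<in> names c" for w
  proof (rule eq_if_same_lower, rule iffI)
    fix p assume "p \<le> w \<in>\<^sub>B s"
    then show "p \<le> \<phi> w"
      by (rule memberE) (use s X w ext in \<open>auto simp: extensional_def\<close>)
  next
    fix p assume p: "p \<le> \<phi> w"
    show "p \<le> w \<in>\<^sub>B s"
      using bound[OF w p]
    proof (rule le_SUPE)
      fix x q assume x: "x \<in> X" "q \<le> p" "q \<le> x =\<^sub>B w"
      have "q \<le> \<phi> x"
        using ext w X(2) x(1) equal_sym[OF x(3)] order_trans[OF x(2) p]
        unfolding extensional_def by blast
      then show "q \<le> w \<in>\<^sub>B s" using s x by (intro memberI[of x]) auto
    qed
  qed
  then show thesis using s(1) that by blast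
qed

section \<open>Truth values of formulas\<close>

definition truth :: "(nat \<Rightarrow> 'v) \<Rightarrow> 'v form \<Rightarrow> 'a"
  where "truth \<rho> \<phi> = tfst (form_val c \<rho> \<phi>)"

lemma truth_simps [simp]:
  "truth \<rho> (s \<^bold>\<in> t) = trm_val \<rho> s \<in>\<^sub>B trm_val \<rho> t"
  "truth \<rho> (s \<^bold>\<approx> t) = trm_val \<rho> s =\<^sub>B trm_val \<rho> t"
  "truth \<rho> (\<phi> \<^bold>\<and> \<psi>) = truth \<rho> \<phi> \<sqinter> truth \<rho> \<psi>"
  "truth \<rho> (\<phi> \<^bold>\<or> \<psi>) = truth \<rho> \<phi> \<squnion> truth \<rho> \<psi>"
  "truth \<rho> (\<phi> \<^bold>\<longrightarrow> \<psi>) = - truth \<rho> \<phi> \<squnion> truth \<rho> \<psi>"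
  "truth \<rho> (\<^bold>\<sim> \<phi>) = - truth \<rho> \<phi>"
  "truth \<rho> (\<^bold>\<forall>x. \<phi>) = (\<Sqinter>u\<in>names c. truth (\<rho>(x := u)) \<phi>)"
  "truth \<rho> (\<^bold>\<exists>x. \<phi>) = (\<Squnion>u\<in>names c. truth (\<rho>(x := u)) \<phi>)"
  by (simp_all add: truth_def member_def equal_def twist_components timp_components
      tsneg_components image_image)

lemma valid_iff: "valid c \<phi> \<longleftrightarrow> (\<forall>\<rho>. range \<rho> \<subseteq> names c \<longrightarrow> truth \<rho> \<phi> = \<top>)"
  by (simp add: valid_def truth_def designated_def)

lemma validI: "(\<And>\<rho>. range \<rho> \<subseteq> names c \<Longrightarrow> \<top> \<le> truth \<rho> \<phi>) \<Longrightarrow> valid c \<phi>"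
  by (simp add: valid_iff top_unique)

lemma truth_allI: "(\<And>u. u \<in> names c \<Longrightarrow> p \<le> truth (\<rho>(x := u)) \<phi>) \<Longrightarrow> p \<le> truth \<rho> (\<^bold>\<forall>x. \<phi>)"
  by (simp add: INF_greatest)

lemma truth_exI: "u \<in> names c \<Longrightarrow> p \<le> truth (\<rho>(x := u)) \<phi> \<Longrightarrow> p \<le> truth \<rho> (\<^bold>\<exists>x. \<phi>)"
  by (simp add: le_SUPI)

lemma truth_impI:
  "(\<And>q. q \<le> p \<Longrightarrow> q \<le> truth \<rho> \<phi> \<Longrightarrow> q \<le> truth \<rho> \<psi>) \<Longrightarrow> p \<le> truth \<rho> (\<phi> \<^bold>\<longrightarrow> \<psi>)"
  by (simp add: le_impI)

lemma member_cong:
  assumes "p \<le> u =\<^sub>B u'" "p \<le> v =\<^sub>B v'" "p \<le> u \<in>\<^sub>B v"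
  shows "p \<le> u' \<in>\<^sub>B v'"
  by (rule member_equal_right[OF member_equal_left[OF assms(3,1)] assms(2)])

lemma equal_cong:
  assumes "p \<le> u =\<^sub>B u'" "p \<le> v =\<^sub>B v'" "p \<le> u =\<^sub>B v"
  shows "p \<le> u' =\<^sub>B v'"
  by (rule equal_trans[OF equal_trans[OF equal_sym[OF assms(1)] assms(3)] assms(2)])

lemma trm_val_equal:
  assumes "\<And>y. y \<in> trm_vars t \<Longrightarrow> p \<le> \<rho> y =\<^sub>B \<rho>' y"
  shows "p \<le> trm_val \<rho> t =\<^sub>B trm_val \<rho>' t"
  using assms by (cases t) auto

text \<open>
  Relativizing the equality of the assignments to a condition \<open>p\<close> and to the free variables makes this
  both the Leibniz law (equality below \<open>p\<close>) and the coincidence lemma (equality of value \<open>\<top>\<close>).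
  The converse implication, which the cases of implication and negation use, follows by symmetry.
\<close>

lemma truth_cong:
  assumes "\<And>y. y \<in> free_vars \<phi> \<Longrightarrow> p \<le> \<rho> y =\<^sub>B \<rho>' y" "p \<le> truth \<rho> \<phi>"
  shows "p \<le> truth \<rho>' \<phi>"
  using assms
proof (induction \<phi> arbitrary: p \<rho> \<rho>')
  case (Mem s t)
  then show ?case
    using member_cong[OF trm_val_equal[of s p \<rho> \<rho>'] trm_val_equal[of t p \<rho> \<rho>']] by simp
next
  case (Eql s t)
  then show ?case
    using equal_cong[OF trm_val_equal[of s p \<rho> \<rho>'] trm_val_equal[of t p \<rho> \<rho>']] by simp
next
  case (Conj \<phi> \<psi>)
  show ?case using Conj.IH[of p \<rho> \<rho>'] Conj.prems by simp
next
  case (Disj \<phi> \<psi>)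
  from Disj.prems(2) have "p \<le> truth \<rho> \<phi> \<squnion> truth \<rho> \<psi>" by simp
  then show ?case
  proof (rule le_supE)
    fix q assume q: "q \<le> p" "q \<le> truth \<rho> \<phi>"
    have "q \<le> truth \<rho>' \<phi>"
      by (rule Disj.IH(1)[OF _ q(2)]) (use Disj.prems(1) order_trans[OF q(1)] in simp)
    then show "q \<le> truth \<rho>' (\<phi> \<^bold>\<or> \<psi>)" by (simp add: le_supI1)
  next
    fix q assume q: "q \<le> p" "q \<le> truth \<rho> \<psi>"
    have "q \<le> truth \<rho>' \<psi>"
      by (rule Disj.IH(2)[OF _ q(2)]) (use Disj.prems(1) order_trans[OF q(1)] in simp)
    then show "q \<le> truth \<rho>' (\<phi> \<^bold>\<or> \<psi>)" by (simp add: le_supI2)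
  qed
next
  case (Impl \<phi> \<psi>)
  show ?case
  proof (rule truth_impI)
    fix q assume q: "q \<le> p" "q \<le> truth \<rho>' \<phi>"
    have eq: "q \<le> \<rho> y =\<^sub>B \<rho>' y" if "y \<in> free_vars (\<phi> \<^bold>\<longrightarrow> \<psi>)" for y
      using Impl.prems(1)[OF that] q(1) by simp
    have "q \<le> truth \<rho> \<phi>"
      by (rule Impl.IH(1)[OF _ q(2)]) (use eq equal_sym in simp)
    moreover have "q \<le> - truth \<rho> \<phi> \<squnion> truth \<rho> \<psi>"
      using order_trans[OF q(1) Impl.prems(2)] by simp
    ultimately have "q \<le> truth \<rho> \<psi>" by (rule le_impD[rotated])
    then show "q \<le> truth \<rho>' \<psi>"
      by (rule Impl.IH(2)[rotated]) (use eq in simp)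
  qed
next
  case (Neg \<phi>)
  have "p \<le> - truth \<rho>' \<phi>"
  proof (rule le_complI)
    fix q assume q: "q \<le> p" "q \<le> truth \<rho>' \<phi>"
    have "q \<le> truth \<rho> \<phi>"
      by (rule Neg.IH[OF _ q(2)]) (use Neg.prems(1) order_trans[OF q(1)] equal_sym in simp)
    moreover have "q \<le> - truth \<rho> \<phi>" using order_trans[OF q(1) Neg.prems(2)] by simp
    ultimately show "q \<le> \<bottom>" by (rule le_complD[rotated])
  qed
  then show ?case by simp
next
  case (All x \<phi>)
  show ?case
  proof (rule truth_allI)
    fix u assume u: "u \<in> names c"
    have "p \<le> truth (\<rho>(x := u)) \<phi>" using All.prems(2) u by (simp add: le_INF_iff)
    then show "p \<le> truth (\<rho>'(x := u)) \<phi>"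
      by (rule All.IH[rotated]) (use All.prems(1) in simp)
  qed
next
  case (Ex x \<phi>)
  from Ex.prems(2) have "p \<le> (\<Squnion>u\<in>names c. truth (\<rho>(x := u)) \<phi>)" by simp
  then show ?case
  proof (rule le_SUPE)
    fix u q assume u: "u \<in> names c" and q: "q \<le> p" "q \<le> truth (\<rho>(x := u)) \<phi>"
    have "q \<le> truth (\<rho>'(x := u)) \<phi>"
      by (rule Ex.IH[OF _ q(2)]) (use Ex.prems(1) order_trans[OF q(1)] in simp)
    then show "q \<le> truth \<rho>' (\<^bold>\<exists>x. \<phi>)" by (rule truth_exI[OF u])
  qed
qed

lemma truth_coincidence:
  assumes "\<And>y. y \<in> free_vars \<phi> \<Longrightarrow> \<rho> y = \<rho>' y"
  shows "truth \<rho> \<phi> = truth \<rho>' \<phi>"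
  by (rule order.antisym; rule truth_cong[OF _ order_refl]) (simp_all add: assms)

lemma truth_upd_equal: "p \<le> u =\<^sub>B v \<Longrightarrow> p \<le> truth (\<rho>(x := u)) \<phi> \<Longrightarrow> p \<le> truth (\<rho>(x := v)) \<phi>"
  by (erule truth_cong[rotated]) simp

lemma truth_upd_irrelevant: "x \<notin> free_vars \<phi> \<Longrightarrow> truth (\<rho>(x := u)) \<phi> = truth \<rho> \<phi>"
  by (rule truth_coincidence) auto


section \<open>Soundness of the calculus\<close>

lemma trm_val_subst: "trm_val \<rho> (trm_subst x t s) = trm_val (\<rho>(x := trm_val \<rho> t)) s"
  by (cases s) auto

lemma trm_subst_irrelevant: "x \<notin> trm_vars s \<Longrightarrow> trm_subst x t s = s"
  by (cases s) auto

lemma subst_irrelevant: "x \<notin> free_vars \<phi> \<Longrightarrow> subst x t \<phi> = \<phi>"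
  by (induction \<phi>) (auto simp: trm_subst_irrelevant)

lemma trm_val_upd_irrelevant: "x \<notin> trm_vars t \<Longrightarrow> trm_val (\<rho>(x := u)) t = trm_val \<rho> t"
  by (cases t) auto

lemma truth_subst:
  "free_for t x \<phi> \<Longrightarrow> truth \<rho> (subst x t \<phi>) = truth (\<rho>(x := trm_val \<rho> t)) \<phi>"
proof (induction \<phi> arbitrary: \<rho>)
  case (All y \<phi>)
  show ?case
  proof (cases "x \<in> free_vars (\<^bold>\<forall>y. \<phi>)")
    case True
    then have y: "x \<noteq> y" "y \<notin> trm_vars t" "free_for t x \<phi>" using All.prems by auto
    have "truth (\<rho>(y := u)) (subst x t \<phi>) = truth (\<rho>(x := trm_val \<rho> t, y := u)) \<phi>" for u
      by (simp only: All.IH[OF y(3)] trm_val_upd_irrelevant[OF y(2)] fun_upd_twist[OF y(1)])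
    then show ?thesis by (simp only: subst.simps truth_simps if_not_P[OF y(1)[symmetric]])
  next
    case False
    then show ?thesis
      by (metis subst_irrelevant truth_upd_irrelevant)
  qed
next
  case (Ex y \<phi>)
  show ?case
  proof (cases "x \<in> free_vars (\<^bold>\<exists>y. \<phi>)")
    case True
    then have y: "x \<noteq> y" "y \<notin> trm_vars t" "free_for t x \<phi>" using Ex.prems by auto
    have "truth (\<rho>(y := u)) (subst x t \<phi>) = truth (\<rho>(x := trm_val \<rho> t, y := u)) \<phi>" for u
      by (simp only: Ex.IH[OF y(3)] trm_val_upd_irrelevant[OF y(2)] fun_upd_twist[OF y(1)])
    then show ?thesis by (simp only: subst.simps truth_simps if_not_P[OF y(1)[symmetric]])
  next
    case False
    then show ?thesis
      by (metis subst_irrelevant truth_upd_irrelevant)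
  qed
qed (simp_all add: trm_val_subst)

lemma set_trm_subst: "x \<in> trm_vars s \<Longrightarrow> set_trm t \<subseteq> set_trm (trm_subst x t s)"
  by (cases s) auto

lemma set_form_subst: "x \<in> free_vars \<phi> \<Longrightarrow> set_trm t \<subseteq> set_form (subst x t \<phi>)"
  by (induction \<phi>) (use set_trm_subst in fastforce)+

lemma trm_val_names: "set_trm t \<subseteq> names c \<Longrightarrow> range \<rho> \<subseteq> names c \<Longrightarrow> trm_val \<rho> t \<in> names c"
  by (cases t) auto

text \<open>
  Quantifiers range over names, so the value of \<open>t\<close> has to be a name.  It is, if \<open>x\<close> occurs
  free, because then the constants of \<open>t\<close> occur in the instance; otherwise \<open>t\<close> disappears and every
  name serves as \<open>u\<close>.
\<close>

lemma truth_subst_instance: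
  assumes "free_for t x \<phi>" "set_form (subst x t \<phi>) \<subseteq> names c" "range \<rho> \<subseteq> names c"
  obtains u where "u \<in> names c" "truth \<rho> (subst x t \<phi>) = truth (\<rho>(x := u)) \<phi>"
proof (cases "x \<in> free_vars \<phi>")
  case True
  then have "set_trm t \<subseteq> names c" using set_form_subst assms(2) by blast
  then show ?thesis using that trm_val_names assms(3) truth_subst[OF assms(1)] by blast
next
  case False
  then have "truth \<rho> (subst x t \<phi>) = truth (\<rho>(x := \<rho> x)) \<phi>" by (simp add: subst_irrelevant)
  then show ?thesis using that assms(3) by blast
qed

text \<open>
  In the quantifier axioms the term \<open>t\<close> has to denote a name, since quantifiers range over names;
  this is what membership in the language provides.
\<close>

lemma logical_axioms_valid:
  assumes "\<phi> \<in> logical_axioms" "\<phi> \<in> lang (names c)"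
  shows "valid c \<phi>"
proof (rule validI)
  fix \<rho> :: "nat \<Rightarrow> 'v" assume \<rho>: "range \<rho> \<subseteq> names c"
  show "\<top> \<le> truth \<rho> \<phi>"
    using assms
  proof cases
    case (1 \<phi> \<psi>)
    then show ?thesis by (auto intro!: truth_impI)
  next
    case (2 \<phi> \<psi> \<chi>)
    have "q \<le> truth \<rho> \<chi>"
      if "q \<le> r" "r \<le> s" "q \<le> truth \<rho> \<phi>" "r \<le> truth \<rho> (\<phi> \<^bold>\<longrightarrow> \<psi>)" "s \<le> truth \<rho> (\<phi> \<^bold>\<longrightarrow> \<psi> \<^bold>\<longrightarrow> \<chi>)" for q r s
    proof -
      have "q \<le> truth \<rho> \<psi>" using that by (auto intro: le_impD order_trans)
      moreover have "q \<le> - truth \<rho> \<psi> \<squnion> truth \<rho> \<chi>"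
        using that by (auto intro: le_impD[of q "truth \<rho> \<phi>"] order_trans)
      ultimately show ?thesis by (rule le_impD[rotated])
    qed
    then show ?thesis unfolding 2 by (intro truth_impI)
  next
    case (3 \<phi> \<psi>)
    have "- (- (- x) \<squnion> - y) \<squnion> (- y \<squnion> x) = \<top>" for x y :: 'a
      by (simp add: sup_commute sup_eq_top_iff)
    then show ?thesis unfolding 3 by simp
  next
    case (4 \<phi> \<psi>)
    then show ?thesis by (auto intro!: truth_impI)
  next
    case (5 \<phi> \<psi>)
    then show ?thesis by (auto intro!: truth_impI)
  next
    case (6 \<phi> \<psi>)
    then show ?thesis unfolding 6 by (intro truth_impI) auto
  next
    case (7 \<phi> \<psi>)
    then show ?thesis unfolding 7 by (intro truth_impI) (simp add: le_supI1)
  next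
    case (8 \<phi> \<psi>)
    then show ?thesis unfolding 8 by (intro truth_impI) (simp add: le_supI2)
  next
    case (9 \<phi> \<psi> \<chi>)
    have "q \<le> truth \<rho> \<psi>"
      if "q \<le> r" "r \<le> s" "q \<le> truth \<rho> (\<phi> \<^bold>\<or> \<chi>)" "r \<le> truth \<rho> (\<chi> \<^bold>\<longrightarrow> \<psi>)" "s \<le> truth \<rho> (\<phi> \<^bold>\<longrightarrow> \<psi>)" for q r s
    proof -
      have imp: "q \<le> - truth \<rho> \<phi> \<squnion> truth \<rho> \<psi>" "q \<le> - truth \<rho> \<chi> \<squnion> truth \<rho> \<psi>"
        using that by (auto intro: order_trans)
      show ?thesis
        using that(3)[unfolded truth_simps]
      proof (rule le_supE)
        show "t \<le> truth \<rho> \<psi>" if "t \<le> q" "t \<le> truth \<rho> \<phi>" for t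
          by (rule le_impD[OF order_trans[OF that(1) imp(1)] that(2)])
        show "t \<le> truth \<rho> \<psi>" if "t \<le> q" "t \<le> truth \<rho> \<chi>" for t
          by (rule le_impD[OF order_trans[OF that(1) imp(2)] that(2)])
      qed
    qed
    then show ?thesis unfolding 9 by (intro truth_impI)
  next
    case (10 t x \<phi>)
    have "set_form (subst x t \<phi>) \<subseteq> names c" using assms(2) unfolding 10(1) lang_def by simp
    then obtain u where "u \<in> names c" "truth \<rho> (subst x t \<phi>) = truth (\<rho>(x := u)) \<phi>"
      using truth_subst_instance[OF 10(2) _ \<rho>] by blast
    then show ?thesis unfolding 10(1) by (intro truth_impI) (simp add: le_INF_iff)
  next
    case (11 x \<phi> \<psi>)
    have "q \<le> truth \<rho> (\<^bold>\<forall>x. \<psi>)" if "q \<le> r" "q \<le> truth \<rho> \<phi>" "r \<le> truth \<rho> (\<^bold>\<forall>x. \<phi> \<^bold>\<longrightarrow> \<psi>)" for q r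
    proof (rule truth_allI)
      fix u assume "u \<in> names c"
      then have "q \<le> - truth (\<rho>(x := u)) \<phi> \<squnion> truth (\<rho>(x := u)) \<psi>"
        using order_trans[OF that(1,3)] by (simp add: le_INF_iff)
      then show "q \<le> truth (\<rho>(x := u)) \<psi>"
        by (rule le_impD) (simp add: truth_upd_irrelevant 11 that)
    qed
    then show ?thesis unfolding 11(1) by (intro truth_impI)
  next
    case (12 t x \<phi>)
    have "set_form (subst x t \<phi>) \<subseteq> names c" using assms(2) unfolding 12(1) lang_def by simp
    then obtain u where "u \<in> names c" "truth \<rho> (subst x t \<phi>) = truth (\<rho>(x := u)) \<phi>"
      using truth_subst_instance[OF 12(2) _ \<rho>] by blast
    then show ?thesis unfolding 12(1) by (intro truth_impI truth_exI) simp_all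
  next
    case (13 x \<psi> \<phi>)
    have "q \<le> truth \<rho> \<psi>" if "q \<le> r" "q \<le> truth \<rho> (\<^bold>\<exists>x. \<phi>)" "r \<le> truth \<rho> (\<^bold>\<forall>x. \<phi> \<^bold>\<longrightarrow> \<psi>)" for q r
      using that(2)[unfolded truth_simps]
    proof (rule le_SUPE)
      fix u s assume u: "u \<in> names c" and s: "s \<le> q" "s \<le> truth (\<rho>(x := u)) \<phi>"
      have "s \<le> - truth (\<rho>(x := u)) \<phi> \<squnion> truth (\<rho>(x := u)) \<psi>"
        using order_trans[OF s(1) order_trans[OF that(1,3)]] u by (simp add: le_INF_iff)
      then have "s \<le> truth (\<rho>(x := u)) \<psi>" using s(2) by (rule le_impD)
      then show "s \<le> truth \<rho> \<psi>" by (simp add: truth_upd_irrelevant 13)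
    qed
    then show ?thesis unfolding 13(1) by (intro truth_impI)
  next
    case (14 t)
    then show ?thesis by simp
  next
    case (15 s x \<phi> t)
    have "q \<le> truth \<rho> (subst x t \<phi>)"
      if "q \<le> r" "q \<le> truth \<rho> (subst x s \<phi>)" "r \<le> truth \<rho> (s \<^bold>\<approx> t)" for q r
      using that truth_upd_equal[of q "trm_val \<rho> s" "trm_val \<rho> t" \<rho> x \<phi>]
      by (simp add: truth_subst 15 order_trans[OF that(1)])
    then show ?thesis unfolding 15(1) by (intro truth_impI)
  qed
qed

lemma valid_modus_ponens: "valid c (\<phi> \<^bold>\<longrightarrow> \<psi>) \<Longrightarrow> valid c \<phi> \<Longrightarrow> valid c \<psi>"
  by (simp add: valid_iff)

lemma valid_generalization:
  assumes "valid c \<phi>"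
  shows "valid c (\<^bold>\<forall>x. \<phi>)"
proof (rule validI, rule truth_allI)
  fix \<rho> :: "nat \<Rightarrow> 'v" and u assume "range \<rho> \<subseteq> names c" "u \<in> names c"
  then have "range (\<rho>(x := u)) \<subseteq> names c" by auto
  then show "\<top> \<le> truth (\<rho>(x := u)) \<phi>" using assms by (simp add: valid_iff)
qed

lemma theorems_valid:
  assumes "\<And>\<phi>. \<phi> \<in> zfc_axioms (names c) \<Longrightarrow> valid c \<phi>" "\<phi> \<in> zfc_theorems (names c)"
  shows "valid c \<phi>"
  using assms(2)
  by induction (auto intro: assms(1) logical_axioms_valid valid_modus_ponens valid_generalization)

section \<open>Axioms of set existence\<close>

lemma truth_iffI:
  assumes "\<And>q. q \<le> p \<Longrightarrow> q \<le> truth \<rho> \<phi> \<Longrightarrow> q \<le> truth \<rho> \<psi>"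
    and "\<And>q. q \<le> p \<Longrightarrow> q \<le> truth \<rho> \<psi> \<Longrightarrow> q \<le> truth \<rho> \<phi>"
  shows "p \<le> truth \<rho> (\<phi> \<^bold>\<longleftrightarrow> \<psi>)"
  using le_iffI[OF assms] by simp

lemma truth_mp: "p \<le> truth \<rho> (\<phi> \<^bold>\<longrightarrow> \<psi>) \<Longrightarrow> p \<le> truth \<rho> \<phi> \<Longrightarrow> p \<le> truth \<rho> \<psi>"
  by (auto intro: le_impD)

lemma truth_allD: "p \<le> truth \<rho> (\<^bold>\<forall>x. \<phi>) \<Longrightarrow> u \<in> names c \<Longrightarrow> p \<le> truth (\<rho>(x := u)) \<phi>"
  by (simp add: le_INF_iff)

lemma truth_exE:
  assumes "p \<le> truth \<rho> (\<^bold>\<exists>x. \<phi>)"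
    and "\<And>u q. u \<in> names c \<Longrightarrow> q \<le> p \<Longrightarrow> q \<le> truth (\<rho>(x := u)) \<phi> \<Longrightarrow> q \<le> z"
  shows "p \<le> z"
  using assms(1)[unfolded truth_simps] by (rule le_SUPE) (rule assms(2))

text \<open>
  Axioms of the form \<open>\<exists>b. \<forall>x. x \<in> b \<longleftrightarrow> \<phi>\<close>, relativized to a condition \<open>p\<close>: the cover is required below
  \<open>p\<close> only.  Replacement needs this, since its functionality premise holds merely below a condition.
\<close>

lemma set_existence:
  assumes X: "small X" "X \<subseteq> names c" and b: "b \<noteq> x" "b \<notin> free_vars \<phi>"
    and bound: "\<And>w q. w \<in> names c \<Longrightarrow> q \<le> p \<Longrightarrow> q \<le> truth (\<rho>(x := w)) \<phi> \<Longrightarrow> q \<le> (\<Squnion>v\<in>X. v =\<^sub>B w)"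
  shows "p \<le> truth \<rho> (\<^bold>\<exists>b. \<^bold>\<forall>x. Var x \<^bold>\<in> Var b \<^bold>\<longleftrightarrow> \<phi>)"
proof -
  have "extensional (\<lambda>w. p \<sqinter> truth (\<rho>(x := w)) \<phi>)"
    by (rule extensionalI) (auto intro: truth_upd_equal)
  then obtain s where s: "s \<in> names c" "\<And>w. w \<in> names c \<Longrightarrow> w \<in>\<^sub>B s = p \<sqinter> truth (\<rho>(x := w)) \<phi>"
    by (rule comprehension[OF X]) (use bound in auto)
  have val: "truth (\<rho>(b := s, x := w)) (Var x \<^bold>\<in> Var b) = p \<sqinter> truth (\<rho>(x := w)) \<phi>"
    "truth (\<rho>(b := s, x := w)) \<phi> = truth (\<rho>(x := w)) \<phi>" if "w \<in> names c" for w
    using s(2)[OF that] b by (auto intro: truth_coincidence)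
  show ?thesis
    by (rule truth_exI[OF s(1)], rule truth_allI, rule truth_iffI) (simp_all only: val le_inf_iff)
qed

lemma pairing_valid: "valid c pairing_axiom"
  unfolding pairing_axiom_def
proof (intro validI truth_allI)
  fix \<rho> :: "nat \<Rightarrow> 'v" and u v assume "u \<in> names c" "v \<in> names c"
  then show "\<top> \<le> truth (\<rho>(0 := u, 1 := v)) (\<^bold>\<exists>2. \<^bold>\<forall>3. Var 3 \<^bold>\<in> Var 2 \<^bold>\<longleftrightarrow> Var 3 \<^bold>\<approx> Var 0 \<^bold>\<or> Var 3 \<^bold>\<approx> Var 1)"
    by (intro set_existence[of "{u, v}"] small_doubleton) (auto simp: equal_commute)
qed

lemma union_valid: "valid c union_axiom"
  unfolding union_axiom_def
proof (intro validI truth_allI)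
  fix \<rho> :: "nat \<Rightarrow> 'v" and u assume u: "u \<in> names c"
  let ?X = "\<Union>y\<in>dom_of u. dom_of y"
  show "\<top> \<le> truth (\<rho>(0 := u)) (\<^bold>\<exists>1. \<^bold>\<forall>2. Var 2 \<^bold>\<in> Var 1 \<^bold>\<longleftrightarrow> (\<^bold>\<exists>3. Var 3 \<^bold>\<in> Var 0 \<^bold>\<and> Var 2 \<^bold>\<in> Var 3))"
  proof (rule set_existence[of ?X])
    show "small ?X" by (intro small_Union small_dom_of)
    show "?X \<subseteq> names c" using u dom_of_names by blast
    fix w q
    assume "q \<le> truth (\<rho>(0 := u, 2 := w)) (\<^bold>\<exists>3. Var 3 \<^bold>\<in> Var 0 \<^bold>\<and> Var 2 \<^bold>\<in> Var 3)"
    then show "q \<le> (\<Squnion>v\<in>?X. v =\<^sub>B w)"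
    proof (rule truth_exE)
      fix y r assume "r \<le> truth (\<rho>(0 := u, 2 := w, 3 := y)) (Var 3 \<^bold>\<in> Var 0 \<^bold>\<and> Var 2 \<^bold>\<in> Var 3)"
      then have y: "r \<le> y \<in>\<^sub>B u" "r \<le> w \<in>\<^sub>B y" by simp_all
      from y(1) show "r \<le> (\<Squnion>v\<in>?X. v =\<^sub>B w)"
      proof (rule memberE)
        fix y' s assume y': "y' \<in> dom_of u" "s \<le> r" "s \<le> y' =\<^sub>B y"
        have "s \<le> w \<in>\<^sub>B y'"
          by (rule member_equal_right[OF order_trans[OF y'(2) y(2)] equal_sym[OF y'(3)]])
        then show "s \<le> (\<Squnion>v\<in>?X. v =\<^sub>B w)"
        proof (rule memberE)
          fix x t assume "x \<in> dom_of y'" "t \<le> x =\<^sub>B w"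
          then show "t \<le> (\<Squnion>v\<in>?X. v =\<^sub>B w)" using y'(1) by (intro le_SUPI[of x]) auto
        qed
      qed
    qed
  qed auto
qed

text \<open>
  A name that is a subset of \<open>u\<close> below \<open>p\<close> need not have its domain in that of \<open>u\<close>.  The name
  \<open>s\<close> that gives to each \<open>x\<close> in the domain of \<open>u\<close> the weight \<open>x \<in>\<^sub>B w\<close> does, and is equal to it below \<open>p\<close>.
\<close>

lemma subset_named_in_domain:
  assumes u: "u \<in> names c" and sub: "\<And>x. x \<in> names c \<Longrightarrow> p \<le> - x \<in>\<^sub>B w \<squnion> x \<in>\<^sub>B u"
    and w: "w \<in> names c"
  obtains s where "s \<in> names c" "dom_of s = dom_of u" "p \<le> s =\<^sub>B w"
proof -
  obtain s where s: "s \<in> names c" "dom_of s = dom_of u"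
    and weight: "\<And>x. x \<in> dom_of u \<Longrightarrow> weight s x = x \<in>\<^sub>B w"
    using name_from[OF small_dom_of dom_of_names[OF u], of "\<lambda>x. x \<in>\<^sub>B w"] by blast
  have "p \<le> s =\<^sub>B w"
  proof (rule equalI)
    fix x q assume "x \<in> dom_of s" "q \<le> weight s x"
    then show "q \<le> x \<in>\<^sub>B w" using weight s(2) by simp
  next
    fix y q assume y: "y \<in> dom_of w" "q \<le> p" "q \<le> weight w y"
    have yw: "q \<le> y \<in>\<^sub>B w" using y weight_le_member order_trans by blast
    have "y \<in> names c" using y(1) w dom_of_names by blast
    from order_trans[OF y(2) sub[OF this]] yw have "q \<le> y \<in>\<^sub>B u" by (rule le_impD)
    then show "q \<le> y \<in>\<^sub>B s"
    proof (rule memberE)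
      fix x r assume x: "x \<in> dom_of u" "r \<le> q" "r \<le> x =\<^sub>B y"
      have "r \<le> x \<in>\<^sub>B w" by (rule member_equal_left[OF order_trans[OF x(2) yw] equal_sym[OF x(3)]])
      then show "r \<le> y \<in>\<^sub>B s" using x s(2) weight by (intro memberI[of x]) simp_all
    qed
  qed
  with s show thesis by (rule that)
qed

lemma power_valid: "valid c power_axiom"
  unfolding power_axiom_def
proof (intro validI truth_allI)
  fix \<rho> :: "nat \<Rightarrow> 'v" and u assume u: "u \<in> names c"
  let ?X = "{s \<in> names c. dom_of s = dom_of u}"
  show "\<top> \<le> truth (\<rho>(0 := u)) (\<^bold>\<exists>1. \<^bold>\<forall>2. Var 2 \<^bold>\<in> Var 1 \<^bold>\<longleftrightarrow> (\<^bold>\<forall>3. Var 3 \<^bold>\<in> Var 2 \<^bold>\<longrightarrow> Var 3 \<^bold>\<in> Var 0))"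
  proof (rule set_existence[of ?X])
    show "small ?X" by (intro small_names_with_domain coding small_dom_of)
    fix w q assume w: "w \<in> names c"
      and q: "q \<le> truth (\<rho>(0 := u, 2 := w)) (\<^bold>\<forall>3. Var 3 \<^bold>\<in> Var 2 \<^bold>\<longrightarrow> Var 3 \<^bold>\<in> Var 0)"
    have sub: "q \<le> - x \<in>\<^sub>B w \<squnion> x \<in>\<^sub>B u" if "x \<in> names c" for x
      using truth_allD[OF q that] by simp
    obtain s where "s \<in> names c" "dom_of s = dom_of u" "q \<le> s =\<^sub>B w"
      by (rule subset_named_in_domain[OF u sub w])
    then show "q \<le> (\<Squnion>v\<in>?X. v =\<^sub>B w)" by (intro le_SUPI[of s]) simp_all
  qed auto
qed

lemma separation_valid:
  assumes "distinct [a, b, x]" "b \<notin> free_vars \<phi>"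
  shows "valid c (separation_axiom a b x \<phi>)"
  unfolding separation_axiom_def
proof (intro validI truth_allI)
  fix \<rho> :: "nat \<Rightarrow> 'v" and u assume u: "u \<in> names c"
  show "\<top> \<le> truth (\<rho>(a := u)) (\<^bold>\<exists>b. \<^bold>\<forall>x. Var x \<^bold>\<in> Var b \<^bold>\<longleftrightarrow> Var x \<^bold>\<in> Var a \<^bold>\<and> \<phi>)"
  proof (rule set_existence[of "dom_of u"])
    fix w q assume "q \<le> truth (\<rho>(a := u, x := w)) (Var x \<^bold>\<in> Var a \<^bold>\<and> \<phi>)"
    then have "q \<le> w \<in>\<^sub>B u" using assms(1) by simp
    then show "q \<le> (\<Squnion>v\<in>dom_of u. v =\<^sub>B w)" by (rule memberE) (rule le_SUPI)
  qed (use assms dom_of_names[OF u] in \<open>auto intro: small_dom_of\<close>)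
qed

text \<open>
  A class of names is cut down to a set by keeping, for each \<open>x\<close>, one name for each value that \<open>F x\<close>
  takes; there is only a set of values.
\<close>

lemma small_choice_of_values:
  fixes F :: "'v \<Rightarrow> 'v \<Rightarrow> 'a"
  assumes "small D"
  obtains X where "small X" "X \<subseteq> names c"
    "\<And>x y. x \<in> D \<Longrightarrow> y \<in> names c \<Longrightarrow> \<exists>y'\<in>X. F x y' = F x y"
proof -
  define g where "g x v = (SOME y. y \<in> names c \<and> F x y = v)" for x v
  have g: "g x (F x y) \<in> names c \<and> F x (g x (F x y)) = F x y" if "y \<in> names c" for x y
    unfolding g_def by (rule someI[of _ y]) (simp add: that)
  let ?X = "\<Union>x\<in>D. g x ` (F x ` names c)"
  have "small ?X" using assms by (intro small_Union small_image_algebra[OF coding])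
  moreover have "?X \<subseteq> names c" using g by auto
  moreover have "\<exists>y'\<in>?X. F x y' = F x y" if "x \<in> D" "y \<in> names c" for x y
    using that g[OF that(2)] by blast
  ultimately show thesis by (rule that)
qed

lemma replacement_valid:
  assumes d: "distinct [a, b, x, y, w]" and b: "b \<notin> free_vars \<phi>" and w: "w \<notin> free_vars \<phi>"
  shows "valid c (replacement_axiom a b x y w \<phi>)"
  unfolding replacement_axiom_def
proof (intro validI truth_allI truth_impI)
  fix \<rho> :: "nat \<Rightarrow> 'v" and u p assume u: "u \<in> names c"
    and p: "p \<le> truth (\<rho>(a := u)) (\<^bold>\<forall>x. Var x \<^bold>\<in> Var a \<^bold>\<longrightarrow> (\<^bold>\<exists>w. \<^bold>\<forall>y. \<phi> \<^bold>\<longrightarrow> Var y \<^bold>\<approx> Var w))"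
  have yw: "y \<noteq> w" using d by simp
  define F where "F d e = truth (\<rho>(a := u, x := d, y := e)) \<phi>" for d e
  \<comment> \<open>the two quantifiers bind x and y in opposite orders\<close>
  have F_swap: "truth (\<rho>(a := u, y := e, x := d)) \<phi> = F d e" for d e
    using d by (simp add: F_def fun_upd_twist[of x y])
  have F_w: "truth (\<rho>(a := u, x := d, w := v, y := e)) \<phi> = F d e" for d e v
    unfolding F_def by (rule truth_coincidence) (use w in auto)
  have functional: "q \<le> e =\<^sub>B e'"
    if de: "d \<in> names c" "e \<in> names c" "e' \<in> names c"
      and q: "q \<le> p" "q \<le> d \<in>\<^sub>B u" "q \<le> F d e" "q \<le> F d e'" for d e e' q
  proof -
    have "q \<le> truth (\<rho>(a := u, x := d)) (\<^bold>\<exists>w. \<^bold>\<forall>y. \<phi> \<^bold>\<longrightarrow> Var y \<^bold>\<approx> Var w)"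
      using truth_mp[OF order_trans[OF q(1) truth_allD[OF p de(1)]]] q(2) d by simp
    then show ?thesis
    proof (rule truth_exE)
      fix v r assume r: "r \<le> q" "r \<le> truth (\<rho>(a := u, x := d, w := v)) (\<^bold>\<forall>y. \<phi> \<^bold>\<longrightarrow> Var y \<^bold>\<approx> Var w)"
      have "r \<le> z =\<^sub>B v" if "z \<in> names c" "r \<le> F d z" for z
        using truth_mp[OF truth_allD[OF r(2) that(1)]] that(2) F_w not_sym[OF yw] by simp
      then show "r \<le> e =\<^sub>B e'"
        using de q(3,4) r(1) by (meson equal_trans equal_sym order_trans)
    qed
  qed
  obtain X where X: "small X" "X \<subseteq> names c"
    "\<And>d e. d \<in> dom_of u \<Longrightarrow> e \<in> names c \<Longrightarrow> \<exists>e'\<in>X. F d e' = F d e"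
    using small_choice_of_values[OF small_dom_of] by blast
  show "p \<le> truth (\<rho>(a := u)) (\<^bold>\<exists>b. \<^bold>\<forall>y. Var y \<^bold>\<in> Var b \<^bold>\<longleftrightarrow> (\<^bold>\<exists>x. Var x \<^bold>\<in> Var a \<^bold>\<and> \<phi>))"
  proof (rule set_existence[OF X(1,2)])
    fix e q assume e: "e \<in> names c" and q: "q \<le> p"
      and "q \<le> truth (\<rho>(a := u, y := e)) (\<^bold>\<exists>x. Var x \<^bold>\<in> Var a \<^bold>\<and> \<phi>)"
    from this(3) show "q \<le> (\<Squnion>v\<in>X. v =\<^sub>B e)"
    proof (rule truth_exE)
      fix d r assume "r \<le> q" and "r \<le> truth (\<rho>(a := u, y := e, x := d)) (Var x \<^bold>\<in> Var a \<^bold>\<and> \<phi>)"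
      then have r: "r \<le> q" "r \<le> d \<in>\<^sub>B u" "r \<le> F d e" using d F_swap by simp_all
      from r(2) show "r \<le> (\<Squnion>v\<in>X. v =\<^sub>B e)"
      proof (rule memberE)
        fix d' s assume s: "d' \<in> dom_of u" "s \<le> r" "s \<le> weight u d'" "s \<le> d' =\<^sub>B d"
        have "s \<le> truth (\<rho>(a := u, y := e, x := d)) \<phi>" using order_trans[OF s(2) r(3)] F_swap by simp
        then have F: "s \<le> F d' e"
          using truth_upd_equal[OF equal_sym[OF s(4)]] F_swap by metis
        \<comment> \<open>the chosen witness has the same truth value as e, so functionality identifies the two below s\<close>
        obtain e' where e': "e' \<in> X" "F d' e' = F d' e" using X(3)[OF s(1) e] by blast
        have "s \<le> e' =\<^sub>B e"
        proof (rule functional)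
          show "d' \<in> names c" using s(1) dom_of_names[OF u] by blast
          show "s \<le> d' \<in>\<^sub>B u" using order_trans[OF s(3) weight_le_member[OF s(1)]] .
          show "s \<le> p" using s(2) r(1) q by simp
        qed (use e e' X(2) F in auto)
        then show "s \<le> (\<Squnion>v\<in>X. v =\<^sub>B e)" by (rule le_SUPI[OF e'(1)])
      qed
    qed
  qed (use d b in auto)
qed


section \<open>Extensionality, foundation and infinity\<close>

lemma extensionality_valid: "valid c extensionality_axiom"
  unfolding extensionality_axiom_def
proof (intro validI truth_allI truth_impI)
  fix \<rho> :: "nat \<Rightarrow> 'v" and u v p assume uv: "u \<in> names c" "v \<in> names c"
    and p: "p \<le> truth (\<rho>(0 := u, 1 := v)) (\<^bold>\<forall>2. Var 2 \<^bold>\<in> Var 0 \<^bold>\<longleftrightarrow> Var 2 \<^bold>\<in> Var 1)"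
  have iff: "p \<le> - x \<in>\<^sub>B u \<squnion> x \<in>\<^sub>B v" "p \<le> - x \<in>\<^sub>B v \<squnion> x \<in>\<^sub>B u" if "x \<in> names c" for x
    using truth_allD[OF p that] by simp_all
  have "p \<le> u =\<^sub>B v"
  proof (rule equalI)
    fix x q assume x: "x \<in> dom_of u" "q \<le> p" "q \<le> weight u x"
    show "q \<le> x \<in>\<^sub>B v"
      by (rule le_impD[OF order_trans[OF x(2) iff(1)] order_trans[OF x(3) weight_le_member[OF x(1)]]])
        (use x(1) uv dom_of_names in blast)
  next
    fix x q assume x: "x \<in> dom_of v" "q \<le> p" "q \<le> weight v x"
    show "q \<le> x \<in>\<^sub>B u"
      by (rule le_impD[OF order_trans[OF x(2) iff(2)] order_trans[OF x(3) weight_le_member[OF x(1)]]])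
        (use x(1) uv dom_of_names in blast)
  qed
  then show "p \<le> truth (\<rho>(0 := u, 1 := v)) (Var 0 \<^bold>\<approx> Var 1)" by simp
qed

text \<open>
  If \<open>p\<close> forces that every member of \<open>u\<close> meets \<open>u\<close>, then a condition below \<open>p\<close> that puts \<open>y\<close> into \<open>u\<close>
  also puts some element of the domain of \<open>y\<close> into \<open>u\<close>; induction along domains excludes this.
\<close>

lemma no_minimal_member_empty:
  assumes u: "u \<in> names c"
    and no_min: "\<And>y q. y \<in> names c \<Longrightarrow> q \<le> p \<Longrightarrow> q \<le> y \<in>\<^sub>B u \<Longrightarrow>
      q \<le> (\<Squnion>z\<in>names c. z \<in>\<^sub>B u \<sqinter> z \<in>\<^sub>B y)"
  shows "y \<in> names c \<Longrightarrow> q \<le> p \<Longrightarrow> q \<le> y \<in>\<^sub>B u \<Longrightarrow> q \<le> \<bottom>"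
proof (induction y arbitrary: q rule: wf_induct_rule[OF wf_dom_of])
  case (1 y)
  from no_min[OF 1(2-4)] show ?case
  proof (rule le_SUPE)
    fix z r assume "r \<le> q" "r \<le> z \<in>\<^sub>B u \<sqinter> z \<in>\<^sub>B y"
    then have r: "r \<le> q" "r \<le> z \<in>\<^sub>B u" "r \<le> z \<in>\<^sub>B y" by simp_all
    from r(3) show "r \<le> \<bottom>"
    proof (rule memberE)
      fix x s assume x: "x \<in> dom_of y" "s \<le> r" "s \<le> x =\<^sub>B z"
      have "s \<le> x \<in>\<^sub>B u" by (rule member_equal_left[OF order_trans[OF x(2) r(2)] equal_sym[OF x(3)]])
      moreover have "x \<in> names c" using x(1) 1(2) dom_of_names by blast
      moreover have "s \<le> p" using x(2) r(1) 1(3) by simp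
      ultimately show "s \<le> \<bottom>" using 1(1)[of x s] x(1) by simp
    qed
  qed
qed

lemma foundation_valid: "valid c foundation_axiom"
  unfolding foundation_axiom_def
proof (intro validI truth_allI truth_impI)
  fix \<rho> :: "nat \<Rightarrow> 'v" and u p assume u: "u \<in> names c"
    and p: "p \<le> truth (\<rho>(0 := u)) (\<^bold>\<exists>1. Var 1 \<^bold>\<in> Var 0)"
  let ?N = "\<lambda>y. \<Squnion>z\<in>names c. z \<in>\<^sub>B u \<sqinter> z \<in>\<^sub>B y"
  let ?M = "\<Squnion>y\<in>names c. y \<in>\<^sub>B u \<sqinter> - ?N y"
  \<comment> \<open>contrapositively: below the negation of the conclusion, no member of u is minimal\<close>
  have "p \<le> - (- ?M)"
  proof (rule le_complI)
    fix q assume q: "q \<le> p" "q \<le> - ?M"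
    have no_min: "r \<le> ?N y" if "y \<in> names c" "r \<le> q" "r \<le> y \<in>\<^sub>B u" for y r
    proof -
      have "r \<le> - (- ?N y)"
      proof (rule le_complI)
        fix s assume s: "s \<le> r" "s \<le> - ?N y"
        then have "s \<le> ?M" using that by (intro le_SUPI[of y]) auto
        moreover have "s \<le> - ?M" using s that q by (meson order_trans)
        ultimately show "s \<le> \<bottom>" by (rule le_complD[rotated])
      qed
      then show ?thesis by simp
    qed
    have "q \<le> (\<Squnion>y\<in>names c. y \<in>\<^sub>B u)" using order_trans[OF q(1) p] by simp
    then show "q \<le> \<bottom>"
      by (rule le_SUPE) (rule no_minimal_member_empty[OF u no_min])
  qed
  then show "p \<le> truth (\<rho>(0 := u)) (\<^bold>\<exists>1. Var 1 \<^bold>\<in> Var 0 \<^bold>\<and> \<^bold>\<sim> (\<^bold>\<exists>2. Var 2 \<^bold>\<in> Var 0 \<^bold>\<and> Var 2 \<^bold>\<in> Var 1))"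
    by simp
qed

lemma empty_name: obtains e where "e \<in> names c" "\<And>w. w \<in> names c \<Longrightarrow> w \<in>\<^sub>B e = \<bottom>"
proof -
  obtain e where "e \<in> names c" "dom_of e = {}" using name_from[OF small_empty] by blast
  then show thesis using that by (simp add: member_unfold)
qed

lemma successor_name:
  assumes u: "u \<in> names c"
  shows "\<exists>s\<in>names c. \<forall>w\<in>names c. w \<in>\<^sub>B s = w \<in>\<^sub>B u \<squnion> w =\<^sub>B u"
proof -
  have X: "small (insert u (dom_of u))" "insert u (dom_of u) \<subseteq> names c"
    using u dom_of_names by (auto intro: small_insert small_dom_of)
  have "extensional (\<lambda>w. w \<in>\<^sub>B u \<squnion> w =\<^sub>B u)"
  proof (rule extensionalI)
    fix v w p assume p: "p \<le> v =\<^sub>B w" "p \<le> v \<in>\<^sub>B u \<squnion> v =\<^sub>B u"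
    from p(2) show "p \<le> w \<in>\<^sub>B u \<squnion> w =\<^sub>B u"
    proof (rule le_supE)
      fix q assume "q \<le> p" "q \<le> v \<in>\<^sub>B u"
      then show "q \<le> w \<in>\<^sub>B u \<squnion> w =\<^sub>B u"
        using member_equal_left[of q v u w] p(1) by (simp add: le_supI1)
    next
      fix q assume "q \<le> p" "q \<le> v =\<^sub>B u"
      then show "q \<le> w \<in>\<^sub>B u \<squnion> w =\<^sub>B u"
        using equal_trans[of q w v u] equal_sym p(1) by (simp add: le_supI2)
    qed
  qed
  then obtain s where "s \<in> names c" "\<And>w. w \<in> names c \<Longrightarrow> w \<in>\<^sub>B s = w \<in>\<^sub>B u \<squnion> w =\<^sub>B u"
  proof (rule comprehension[OF X])
    fix w p assume "p \<le> w \<in>\<^sub>B u \<squnion> w =\<^sub>B u"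
    then show "p \<le> (\<Squnion>x\<in>insert u (dom_of u). x =\<^sub>B w)"
    proof (rule le_supE)
      fix q assume "q \<le> w \<in>\<^sub>B u"
      then show "q \<le> (\<Squnion>x\<in>insert u (dom_of u). x =\<^sub>B w)" by (rule memberE) (rule le_SUPI[OF insertI2])
    qed (simp add: equal_commute le_supI1)
  qed blast
  then show ?thesis by blast
qed

lemma infinity_valid: "valid c infinity_axiom"
  unfolding infinity_axiom_def
proof (rule validI)
  fix \<rho> :: "nat \<Rightarrow> 'v"
  obtain e where e: "e \<in> names c" "\<And>w. w \<in> names c \<Longrightarrow> w \<in>\<^sub>B e = \<bottom>" by (rule empty_name) blast
  obtain S where S: "\<And>u. u \<in> names c \<Longrightarrow> S u \<in> names c"
    "\<And>u w. u \<in> names c \<Longrightarrow> w \<in> names c \<Longrightarrow> w \<in>\<^sub>B S u = w \<in>\<^sub>B u \<squnion> w =\<^sub>B u"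
    using successor_name by metis
  define n where "n k = (S ^^ k) e" for k
  have n: "n k \<in> names c" for k by (induction k) (simp_all add: n_def e S)
  obtain s where s: "s \<in> names c" "dom_of s = range n" "\<And>x. x \<in> range n \<Longrightarrow> weight s x = \<top>"
    using name_from[OF small_range_nat[of n], of "\<lambda>_. \<top>"] n by blast
  have mem: "n k \<in>\<^sub>B s = \<top>" for k
    using weight_le_member[of "n k" s] s by (simp add: top_unique)
  let ?suc = "\<^bold>\<exists>2. Var 2 \<^bold>\<in> Var 0 \<^bold>\<and> (\<^bold>\<forall>3. Var 3 \<^bold>\<in> Var 2 \<^bold>\<longleftrightarrow> Var 3 \<^bold>\<in> Var 1 \<^bold>\<or> Var 3 \<^bold>\<approx> Var 1)"
  \<comment> \<open>it suffices to consider the names n k, because truth respects equality\<close>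
  have suc: "\<top> \<le> truth (\<rho>(0 := s, 1 := n k)) ?suc" for k
  proof (rule truth_exI[OF n])
    have "w \<in>\<^sub>B n (Suc k) = w \<in>\<^sub>B n k \<squnion> w =\<^sub>B n k" if "w \<in> names c" for w
      using S(2)[OF n[of k] that] by (simp add: n_def)
    then have "\<top> \<le> truth (\<rho>(0 := s, 1 := n k, 2 := n (Suc k)))
        (\<^bold>\<forall>3. Var 3 \<^bold>\<in> Var 2 \<^bold>\<longleftrightarrow> Var 3 \<^bold>\<in> Var 1 \<^bold>\<or> Var 3 \<^bold>\<approx> Var 1)"
      by (intro truth_allI truth_iffI) simp_all
    then show "\<top> \<le> truth (\<rho>(0 := s, 1 := n k, 2 := n (Suc k)))
        (Var 2 \<^bold>\<in> Var 0 \<^bold>\<and> (\<^bold>\<forall>3. Var 3 \<^bold>\<in> Var 2 \<^bold>\<longleftrightarrow> Var 3 \<^bold>\<in> Var 1 \<^bold>\<or> Var 3 \<^bold>\<approx> Var 1))"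
      using mem[of "Suc k"] unfolding truth_simps(3) by (intro le_infI) simp_all
  qed
  have "\<top> \<le> truth (\<rho>(0 := s)) (\<^bold>\<exists>1. Var 1 \<^bold>\<in> Var 0 \<^bold>\<and> (\<^bold>\<forall>2. \<^bold>\<sim> Var 2 \<^bold>\<in> Var 1))"
    using mem[of 0] e by (intro truth_exI[OF e(1)]) (simp add: n_def)
  moreover have "\<top> \<le> truth (\<rho>(0 := s)) (\<^bold>\<forall>1. Var 1 \<^bold>\<in> Var 0 \<^bold>\<longrightarrow> ?suc)"
  proof (intro truth_allI truth_impI)
    fix u q assume "q \<le> truth (\<rho>(0 := s, 1 := u)) (Var 1 \<^bold>\<in> Var 0)"
    then have "q \<le> u \<in>\<^sub>B s" by simp
    then show "q \<le> truth (\<rho>(0 := s, 1 := u)) ?suc"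
    proof (rule memberE)
      fix x r assume "x \<in> dom_of s" and r: "r \<le> x =\<^sub>B u"
      then obtain k where "x = n k" using s(2) by blast
      then show "r \<le> truth (\<rho>(0 := s, 1 := u)) ?suc"
        using truth_upd_equal[OF r] order_trans[OF top_greatest suc[of k]] by blast
    qed
  qed
  ultimately show "\<top> \<le> truth \<rho> (\<^bold>\<exists>0. (\<^bold>\<exists>1. Var 1 \<^bold>\<in> Var 0 \<^bold>\<and> (\<^bold>\<forall>2. \<^bold>\<sim> Var 2 \<^bold>\<in> Var 1)) \<^bold>\<and>
      (\<^bold>\<forall>1. Var 1 \<^bold>\<in> Var 0 \<^bold>\<longrightarrow> ?suc))"
    by (intro truth_exI[OF s(1)]) (simp only: truth_simps(3) le_inf_iff)
qed


section \<open>Choice\<close>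

text \<open>
  A strict order is what wellfounded induction and the comparison of least members use.
\<close>

lemma strict_well_order:
  obtains r :: "('b \<times> 'b) set" where "wf r" "\<And>x y. x \<noteq> y \<Longrightarrow> (x, y) \<in> r \<or> (y, x) \<in> r"
proof -
  obtain r :: "('b \<times> 'b) set" where "well_order_on UNIV r" using well_order_on by blast
  then have "wf (r - Id)" "total r"
    by (simp_all add: well_order_on_def linear_order_on_def)
  then show thesis using that[of "r - Id"] by (auto simp: total_on_def)
qed

text \<open>
  The extent to which \<open>y\<close> is the \<open>r\<close>-least among the names in \<open>Y\<close> that are members of \<open>x\<close>.
\<close>

definition least_member :: "('v \<times> 'v) set \<Rightarrow> 'v set \<Rightarrow> 'v \<Rightarrow> 'v \<Rightarrow> 'a"
  where "least_member r Y x y = y \<in>\<^sub>B x \<sqinter> - (\<Squnion>z\<in>{z \<in> Y. (z, y) \<in> r}. z \<in>\<^sub>B x)"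

text \<open>
  Either a name that precedes \<open>y\<close> is a member of \<open>x\<close>, or \<open>y\<close> is the least one; a condition splits
  into these two cases, and the first one is settled by induction along \<open>r\<close>.
\<close>

lemma least_member_exists:
  assumes "wf r" "y \<in> Y" "p \<le> y \<in>\<^sub>B x"
  shows "p \<le> (\<Squnion>y\<in>Y. least_member r Y x y)"
  using assms(2,3)
proof (induction y arbitrary: p rule: wf_induct_rule[OF assms(1)])
  case (1 y)
  let ?S = "\<Squnion>z\<in>{z \<in> Y. (z, y) \<in> r}. z \<in>\<^sub>B x"
  have "p \<le> ?S \<squnion> - ?S" by simp
  then show ?case
  proof (rule le_supE)
    fix q assume "q \<le> ?S"
    then show "q \<le> (\<Squnion>y\<in>Y. least_member r Y x y)" by (rule le_SUPE) (use 1(1) in blast)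
  next
    fix q assume "q \<le> p" "q \<le> - ?S"
    then show "q \<le> (\<Squnion>y\<in>Y. least_member r Y x y)"
      using 1(2,3) by (intro le_SUPI[of y]) (auto simp: least_member_def)
  qed
qed

lemma least_member_le:
  assumes "p \<le> least_member r Y x y" "p \<le> z \<in>\<^sub>B x" "z \<in> Y" "(z, y) \<in> r"
  shows "p \<le> v"
proof (rule le_complD)
  show "p \<le> - (\<Squnion>z\<in>{z \<in> Y. (z, y) \<in> r}. z \<in>\<^sub>B x)" using assms(1) by (simp add: least_member_def)
  show "p \<le> (\<Squnion>z\<in>{z \<in> Y. (z, y) \<in> r}. z \<in>\<^sub>B x)" using assms(2-4) by (intro le_SUPI[of z]) auto
qed

text \<open>
  Least members are compared as names and not up to Boolean-valued equality: if they
  differ, one precedes the other and so contradicts the leastness of that other one.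
\<close>

lemma least_member_unique:
  assumes total: "\<And>x y. x \<noteq> y \<Longrightarrow> (x, y) \<in> r \<or> (y, x) \<in> r"
    and Y: "y \<in> Y" "y' \<in> Y"
    and p: "p \<le> least_member r Y x y" "p \<le> least_member r Y x' y'" "p \<le> x =\<^sub>B x'"
  shows "p \<le> y =\<^sub>B y'"
proof -
  have y: "p \<le> y \<in>\<^sub>B x'" using p member_equal_right[of p y x x'] by (simp add: least_member_def)
  have y': "p \<le> y' \<in>\<^sub>B x"
    using p member_equal_right[of p y' x' x] equal_sym by (simp add: least_member_def)
  consider "y = y'" | "(y, y') \<in> r" | "(y', y) \<in> r" using total by blast
  then show ?thesis
  proof cases
    case 1
    then show ?thesis by simp
  next
    case 2
    then show ?thesis using least_member_le[OF p(2) y Y(1)] by blast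
  next
    case 3
    then show ?thesis using least_member_le[OF p(1) y' Y(2)] by blast
  qed
qed

text \<open>
  The transversal consists of the least members of the elements of the domain of \<open>u\<close>.  Pairwise
  disjointness makes two elements that share a member equal, so their least members are equal too.
\<close>

lemma choice_valid: "valid c choice_axiom"
  unfolding choice_axiom_def
proof (intro validI truth_allI truth_impI)
  fix \<rho> :: "nat \<Rightarrow> 'v" and u p assume u: "u \<in> names c"
    and p: "p \<le> truth (\<rho>(0 := u)) ((\<^bold>\<forall>1. Var 1 \<^bold>\<in> Var 0 \<^bold>\<longrightarrow> (\<^bold>\<exists>2. Var 2 \<^bold>\<in> Var 1)) \<^bold>\<and>
        (\<^bold>\<forall>1. \<^bold>\<forall>2. Var 1 \<^bold>\<in> Var 0 \<^bold>\<and> Var 2 \<^bold>\<in> Var 0 \<^bold>\<and>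
          (\<^bold>\<exists>3. Var 3 \<^bold>\<in> Var 1 \<^bold>\<and> Var 3 \<^bold>\<in> Var 2) \<^bold>\<longrightarrow> Var 1 \<^bold>\<approx> Var 2))"
  from p have p1: "p \<le> truth (\<rho>(0 := u)) (\<^bold>\<forall>1. Var 1 \<^bold>\<in> Var 0 \<^bold>\<longrightarrow> (\<^bold>\<exists>2. Var 2 \<^bold>\<in> Var 1))"
    and p2: "p \<le> truth (\<rho>(0 := u)) (\<^bold>\<forall>1. \<^bold>\<forall>2. Var 1 \<^bold>\<in> Var 0 \<^bold>\<and> Var 2 \<^bold>\<in> Var 0 \<^bold>\<and>
          (\<^bold>\<exists>3. Var 3 \<^bold>\<in> Var 1 \<^bold>\<and> Var 3 \<^bold>\<in> Var 2) \<^bold>\<longrightarrow> Var 1 \<^bold>\<approx> Var 2)"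
    by (simp_all only: truth_simps(3) le_inf_iff)
  have nonempty: "q \<le> (\<Squnion>y\<in>names c. y \<in>\<^sub>B x)" if "x \<in> names c" "q \<le> p" "q \<le> x \<in>\<^sub>B u" for x q
    using truth_mp[OF order_trans[OF that(2) truth_allD[OF p1 that(1)]]] that(3) by simp
  have disjoint: "q \<le> x =\<^sub>B y"
    if "x \<in> names c" "y \<in> names c" "z \<in> names c"
      "q \<le> p" "q \<le> x \<in>\<^sub>B u" "q \<le> y \<in>\<^sub>B u" "q \<le> z \<in>\<^sub>B x" "q \<le> z \<in>\<^sub>B y" for x y z q
  proof -
    have "q \<le> (\<Squnion>z\<in>names c. z \<in>\<^sub>B x \<sqinter> z \<in>\<^sub>B y)" using that by (intro le_SUPI[of z]) simp_all
    then show ?thesis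
      using truth_mp[OF order_trans[OF that(4) truth_allD[OF truth_allD[OF p2 that(1)] that(2)]]] that
      by simp
  qed
  obtain r :: "('v \<times> 'v) set" where r: "wf r" "\<And>x y. x \<noteq> y \<Longrightarrow> (x, y) \<in> r \<or> (y, x) \<in> r"
    using strict_well_order by blast
  define Y where "Y = (\<Union>x\<in>dom_of u. dom_of x)"
  have Y: "small Y" "Y \<subseteq> names c"
    unfolding Y_def using dom_of_names u by (blast intro: small_Union small_dom_of)+
  define L where "L = least_member r Y"
  \<comment> \<open>the membership of z in the transversal\<close>
  let ?T = "\<lambda>z. \<Squnion>x\<in>dom_of u. \<Squnion>y\<in>Y. weight u x \<sqinter> L x y \<sqinter> y =\<^sub>B z"
  have T_I: "q \<le> ?T z" if "x \<in> dom_of u" "y \<in> Y" "q \<le> weight u x" "q \<le> L x y" "q \<le> y =\<^sub>B z" for q x y z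
    using that by (intro le_SUPI[of x "dom_of u"] le_SUPI[of y Y]) simp_all
  have T_E: "q \<le> v"
    if "q \<le> ?T z" "\<And>x y s. x \<in> dom_of u \<Longrightarrow> y \<in> Y \<Longrightarrow> s \<le> q \<Longrightarrow> s \<le> weight u x \<Longrightarrow> s \<le> L x y \<Longrightarrow>
      s \<le> y =\<^sub>B z \<Longrightarrow> s \<le> v" for q z v
    using that(1)
  proof (rule le_SUPE)
    fix x k assume x: "x \<in> dom_of u" "k \<le> q" and "k \<le> (\<Squnion>y\<in>Y. weight u x \<sqinter> L x y \<sqinter> y =\<^sub>B z)"
    from this(3) show "k \<le> v"
    proof (rule le_SUPE)
      fix y s assume "y \<in> Y" "s \<le> k" "s \<le> weight u x \<sqinter> L x y \<sqinter> y =\<^sub>B z"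
      then show "s \<le> v" using x by (intro that(2)[of x y s]) auto
    qed
  qed
  have "extensional ?T"
  proof (rule extensionalI)
    fix v w q assume vw: "q \<le> v =\<^sub>B w" and "q \<le> ?T v"
    from this(2) show "q \<le> ?T w"
    proof (rule T_E)
      fix x y s assume s: "x \<in> dom_of u" "y \<in> Y" "s \<le> q" "s \<le> weight u x" "s \<le> L x y" "s \<le> y =\<^sub>B v"
      show "s \<le> ?T w"
        by (rule T_I[OF s(1,2,4,5) equal_trans[OF s(6) order_trans[OF s(3) vw]]])
    qed
  qed
  then obtain t where t: "t \<in> names c" "\<And>w. w \<in> names c \<Longrightarrow> w \<in>\<^sub>B t = ?T w"
    by (rule comprehension[OF Y]) (erule T_E, rule le_SUPI, auto)
  let ?sel = "\<^bold>\<exists>2. \<^bold>\<forall>3. Var 3 \<^bold>\<in> Var 4 \<^bold>\<and> Var 3 \<^bold>\<in> Var 1 \<^bold>\<longleftrightarrow> Var 3 \<^bold>\<approx> Var 2"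
  \<comment> \<open>it suffices to select from the elements of the domain of u, because truth respects equality\<close>
  have sel: "q \<le> truth (\<rho>(0 := u, 4 := t, 1 := x)) ?sel"
    if x: "x \<in> dom_of u" and q: "q \<le> p" "q \<le> weight u x" for x q
  proof -
    have xN: "x \<in> names c" using x dom_of_names[OF u] by blast
    have xu: "q \<le> x \<in>\<^sub>B u" using order_trans[OF q(2) weight_le_member[OF x]] .
    have "q \<le> (\<Squnion>y\<in>Y. L x y)"
      using nonempty[OF xN q(1) xu]
    proof (rule le_SUPE)
      fix y s assume "s \<le> y \<in>\<^sub>B x"
      then show "s \<le> (\<Squnion>y\<in>Y. L x y)"
      proof (rule memberE)
        fix y' s' assume y': "y' \<in> dom_of x" "s' \<le> weight x y'"
        show "s' \<le> (\<Squnion>y\<in>Y. L x y)"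
          unfolding L_def
          by (rule least_member_exists[OF r(1) _ order_trans[OF y'(2) weight_le_member[OF y'(1)]]])
            (use x y' in \<open>auto simp: Y_def\<close>)
      qed
    qed
    then show ?thesis
    proof (rule le_SUPE)
      fix y s assume y: "y \<in> Y" and s: "s \<le> q" "s \<le> L x y"
      have yN: "y \<in> names c" using y Y(2) by blast
      show "s \<le> truth (\<rho>(0 := u, 4 := t, 1 := x)) ?sel"
      proof (rule truth_exI[OF yN], rule truth_allI, rule truth_iffI)
        fix z s' assume z: "z \<in> names c" and s': "s' \<le> s"
          and "s' \<le> truth (\<rho>(0 := u, 4 := t, 1 := x, 2 := y, 3 := z)) (Var 3 \<^bold>\<in> Var 4 \<^bold>\<and> Var 3 \<^bold>\<in> Var 1)"
        then have zt: "s' \<le> ?T z" and zx: "s' \<le> z \<in>\<^sub>B x" using t(2)[OF z] by simp_all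
        from zt have "s' \<le> z =\<^sub>B y"
        proof (rule T_E)
          fix x' y' k assume k: "x' \<in> dom_of u" "y' \<in> Y" "k \<le> s'" "k \<le> weight u x'" "k \<le> L x' y'" "k \<le> y' =\<^sub>B z"
          have le: "k \<le> s" "k \<le> q" "k \<le> p" using k(3) s' s(1) q(1) by auto
          have "k \<le> z \<in>\<^sub>B x'"
            using k(5) member_equal_left[OF _ k(6)] by (simp add: L_def least_member_def)
          moreover have "k \<le> x' \<in>\<^sub>B u" using order_trans[OF k(4) weight_le_member[OF k(1)]] .
          moreover have "x' \<in> names c" using k(1) dom_of_names[OF u] by blast
          ultimately have "k \<le> x =\<^sub>B x'"
            using disjoint[OF xN _ z le(3) order_trans[OF le(2) xu]] order_trans[OF k(3) zx] by blast
          then have "k \<le> y =\<^sub>B y'"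
            using least_member_unique[OF r(2) y k(2)] order_trans[OF le(1) s(2)] k(5)
            unfolding L_def by blast
          then show "k \<le> z =\<^sub>B y" using k(6) equal_sym equal_trans by blast
        qed
        then show "s' \<le> truth (\<rho>(0 := u, 4 := t, 1 := x, 2 := y, 3 := z)) (Var 3 \<^bold>\<approx> Var 2)" by simp
      next
        fix z s' assume z: "z \<in> names c" and s': "s' \<le> s"
          and "s' \<le> truth (\<rho>(0 := u, 4 := t, 1 := x, 2 := y, 3 := z)) (Var 3 \<^bold>\<approx> Var 2)"
        then have yz: "s' \<le> y =\<^sub>B z" by (simp add: equal_commute)
        have L: "s' \<le> L x y" using order_trans[OF s' s(2)] .
        have "s' \<le> ?T z"
          by (rule T_I[OF x y order_trans[OF s' order_trans[OF s(1) q(2)]] L yz])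
        moreover have "s' \<le> z \<in>\<^sub>B x"
          using L member_equal_left[OF _ yz] by (simp add: L_def least_member_def)
        ultimately show "s' \<le> truth (\<rho>(0 := u, 4 := t, 1 := x, 2 := y, 3 := z)) (Var 3 \<^bold>\<in> Var 4 \<^bold>\<and> Var 3 \<^bold>\<in> Var 1)"
          using t(2)[OF z] by simp
      qed
    qed
  qed
  show "p \<le> truth (\<rho>(0 := u)) (\<^bold>\<exists>4. \<^bold>\<forall>1. Var 1 \<^bold>\<in> Var 0 \<^bold>\<longrightarrow> ?sel)"
  proof (rule truth_exI[OF t(1)], intro truth_allI truth_impI)
    fix x q assume q: "q \<le> p" and "q \<le> truth (\<rho>(0 := u, 4 := t, 1 := x)) (Var 1 \<^bold>\<in> Var 0)"
    then have "q \<le> x \<in>\<^sub>B u" by simp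
    then show "q \<le> truth (\<rho>(0 := u, 4 := t, 1 := x)) ?sel"
    proof (rule memberE)
      fix x' s assume s: "x' \<in> dom_of u" "s \<le> q" "s \<le> weight u x'" "s \<le> x' =\<^sub>B x"
      show "s \<le> truth (\<rho>(0 := u, 4 := t, 1 := x)) ?sel"
        by (rule truth_upd_equal[OF s(4) sel[OF s(1) order_trans[OF s(2) q] s(3)]])
    qed
  qed
qed

lemma axioms_valid: "\<phi> \<in> zfc_axioms (names c) \<Longrightarrow> valid c \<phi>"
  unfolding zfc_axioms_def
  using extensionality_valid foundation_valid pairing_valid union_valid power_valid infinity_valid
    choice_valid separation_valid replacement_valid
  by blast

end

theorem theorem9p4:
  fixes c :: "'a::{boolean_algebra, complete_lattice} \<Rightarrow> 'v::zfc_universe"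
  assumes "is_coding c"
  shows "(\<forall>\<phi>\<in>zfc_axioms (names c). valid c \<phi>) \<and> (\<forall>\<phi>\<in>zfc_theorems (names c). valid c \<phi>)"
proof -
  interpret boolean_valued_universe c by standard (rule assms)
  show ?thesis using axioms_valid theorems_valid by blast
qed

end
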